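(* Let $K\subset\hat{\mathbb{C}}$ be a compactum, $f:\hat{\mathbb{C}}\to\hat{\mathbb{C}}$ a rational function of degree at least $2$, $L=f^{-1}(K)$, and $\pi_L:L\to\mathcal{D}_L^{PS}$ the natural projection. Define $\approx$ on $K$ by $x\approx y$ iff $\pi_L(f^{-1}(x))=\pi_L(f^{-1}(y))$. Then $\approx$ is a closed equivalence relation on $K$ and contains $\overline{R_K}$.
   Context: For disjoint simple closed curves $J_1,J_2\subset\hat{\mathbb{C}}$, $U(J_1,J_2)$ is the component of $\hat{\mathbb{C}}\setminus(J_1\cup J_2)$ with boundary $J_1\cup J_2$. The Schönflies relation $R_K$: $x\ne y$ satisfy $(x,y)\in R_K$ if there exist disjoint simple closed curves $J_1\ni x$, $J_2\ni y$ such that $\overline{U(J_1,J_2)}\cap K$ contains an infinite sequence of distinct components $P_n$ each meeting both $J_1$ and $J_2$ whose Hausdorff limit contains $\{x,y\}$; $\overline{R_K}$ is its closure in $K\times K$. A Peano space is a compactum with at most countably many non-degenerate components, each locally connected, and for each $C>0$ only finitely many of diameter $>C$. $\mathcal{D}_L^{PS}$ is the finest monotone (upper semicontinuous, into subcontinua) decomposition of $L$ whose quotient hyperspace is a Peano space (its existence is known). *)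

theory Defs
  imports "HOL-Analysis.Analysis" "HOL-Computational_Algebra.Polynomial_Factorial"
begin

text \<open>The Riemann sphere is modelled as the unit sphere S2 in R^3 (via inverse
stereographic projection from the north pole (0,0,1)), with the Euclidean metric of R^3
(i.e. the chordal metric).\<close>

type_synonym R3 = "real \<times> real \<times> real"

definition S2 :: "R3 set" where
  "S2 = sphere 0 1"

definition north :: R3 where
  "north = (0, 0, 1)"

definition stereo :: "complex \<Rightarrow> R3" where
  "stereo z = (2 * Re z / (cmod z ^ 2 + 1), 2 * Im z / (cmod z ^ 2 + 1),
               (cmod z ^ 2 - 1) / (cmod z ^ 2 + 1))"

text \<open>A rational map of degree d of the sphere: a continuous self-map of S2 that,
in the chart, equals p/q (p, q coprime, q nonzero, max degree = d) off the zeros of q.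
Its values at the poles and at infinity are then forced by continuity.\<close>

definition rational_map :: "(R3 \<Rightarrow> R3) \<Rightarrow> nat \<Rightarrow> bool" where
  "rational_map f d \<longleftrightarrow>
     continuous_on S2 f \<and> f ` S2 \<subseteq> S2 \<and>
     (\<exists>p q :: complex poly. q \<noteq> 0 \<and> coprime p q \<and> max (degree p) (degree q) = d \<and>
        (\<forall>z. poly q z \<noteq> 0 \<longrightarrow> f (stereo z) = stereo (poly p z / poly q z)))"

definition simple_closed_curve :: "R3 set \<Rightarrow> bool" where
  "simple_closed_curve J \<longleftrightarrow>
     J \<subseteq> S2 \<and> (\<exists>g. simple_path g \<and> pathfinish g = pathstart g \<and> path_image g = J)"

definition is_U :: "R3 set \<Rightarrow> R3 set \<Rightarrow> R3 set \<Rightarrow> bool" where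
  "is_U J1 J2 U \<longleftrightarrow>
     U \<in> components (S2 - (J1 \<union> J2)) \<and> (top_of_set S2) frontier_of U = J1 \<union> J2"

definition hausdorff_limit :: "(nat \<Rightarrow> R3 set) \<Rightarrow> R3 set \<Rightarrow> bool" where
  "hausdorff_limit P A \<longleftrightarrow> closed A \<and> A \<noteq> {} \<and>
     (\<forall>e>0. \<forall>\<^sub>F n in sequentially.
        (\<forall>p\<in>P n. \<exists>a\<in>A. dist p a < e) \<and> (\<forall>a\<in>A. \<exists>p\<in>P n. dist a p < e))"

definition schoenflies_rel :: "R3 set \<Rightarrow> (R3 \<times> R3) set" where
  "schoenflies_rel K = {(x, y). x \<in> K \<and> y \<in> K \<and> x \<noteq> y \<and>
     (\<exists>J1 J2 U P A. simple_closed_curve J1 \<and> simple_closed_curve J2 \<and> J1 \<inter> J2 = {} \<and>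
        x \<in> J1 \<and> y \<in> J2 \<and> is_U J1 J2 U \<and> inj P \<and>
        (\<forall>n. P n \<in> components (closure U \<inter> K) \<and> P n \<inter> J1 \<noteq> {} \<and> P n \<inter> J2 \<noteq> {}) \<and>
        hausdorff_limit P A \<and> x \<in> A \<and> y \<in> A)}"

definition peano_space :: "'a topology \<Rightarrow> bool" where
  "peano_space X \<longleftrightarrow> compact_space X \<and> metrizable_space X \<and>
     countable {C \<in> connected_components_of X. \<not> (\<exists>a. C = {a})} \<and>
     (\<forall>C \<in> connected_components_of X. locally_connected_space (subtopology X C)) \<and>
     (\<exists>M d. Metric_space M d \<and> Metric_space.mtopology M d = X \<and>
        (\<forall>c>0. finite {C \<in> connected_components_of X. \<exists>x\<in>C. \<exists>y\<in>C. d x y > c}))"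

definition monotone_decomp :: "R3 set \<Rightarrow> R3 set set \<Rightarrow> bool" where
  "monotone_decomp L D \<longleftrightarrow> \<Union>D = L \<and> disjoint D \<and>
     (\<forall>d\<in>D. d \<noteq> {} \<and> compact d \<and> connected d) \<and>
     (\<forall>d\<in>D. \<forall>U. openin (top_of_set L) U \<and> d \<subseteq> U \<longrightarrow>
        (\<exists>V. openin (top_of_set L) V \<and> d \<subseteq> V \<and> (\<forall>d'\<in>D. d' \<inter> V \<noteq> {} \<longrightarrow> d' \<subseteq> U)))"

definition decomp_topology :: "R3 set \<Rightarrow> R3 set set \<Rightarrow> R3 set topology" where
  "decomp_topology L D = topology (\<lambda>\<U>. \<U> \<subseteq> D \<and> openin (top_of_set L) (\<Union>\<U>))"

definition finest_PS_decomp :: "R3 set \<Rightarrow> R3 set set \<Rightarrow> bool" where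
  "finest_PS_decomp L D \<longleftrightarrow>
     monotone_decomp L D \<and> peano_space (decomp_topology L D) \<and>
     (\<forall>D'. monotone_decomp L D' \<and> peano_space (decomp_topology L D') \<longrightarrow>
        (\<forall>d\<in>D. \<exists>d'\<in>D'. d \<subseteq> d'))"

definition proj_set :: "R3 set set \<Rightarrow> R3 set \<Rightarrow> R3 set set" where
  "proj_set D A = {d \<in> D. d \<inter> A \<noteq> {}}"

end

theory Submission
  imports Defs "HOL-Complex_Analysis.Conformal_Mappings"
begin

text \<open>A nonconstant rational map is open with finite fibres, so points over \<open>x\<close> can be approximated by
points over any sequence converging to \<open>x\<close>; with upper semicontinuity of the decomposition this
makes \<open>\<approx>\<close> closed.

For the inclusion, let \<open>P\<^sub>n\<close> be the components witnessing that \<open>(x, y)\<close> is a Schoenflies pair, and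
lift them to components \<open>Q\<^sub>n\<close> of \<open>f\<^sup>-\<^sup>1(P\<^sub>n)\<close> accumulating at a given \<open>u\<close> over \<open>x\<close> and at some
\<open>v\<close> over \<open>y\<close>. If \<open>u\<close> and \<open>v\<close> had different classes, infinitely many \<open>Q\<^sub>n\<close> would project into one component
of the Peano quotient. By its local connectedness every accumulation point \<open>w\<close> of the
\<open>Q\<^sub>n\<close> has arbitrarily thin connected neighbourhoods of its class that meet almost all \<open>Q\<^sub>n\<close>; as the \<open>Q\<^sub>n\<close>
are distinct components over \<open>closure U\<close>, such a neighbourhood leaves the preimage of \<open>closure U\<close>, and it
can do so only through a point of \<open>Q\<^sub>n\<close> lying over \<open>J\<^sub>1 \<union> J\<^sub>2\<close>. Planarity forces the sets \<open>P\<^sub>n \<inter> J\<^sub>i\<close> to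
shrink to points \<open>a\<^sub>i\<close> along a subsequence. So the class of \<open>w\<close> meets the
finite set \<open>f\<^sup>-\<^sup>1{a\<^sub>1, a\<^sub>2}\<close>, the \<open>Q\<^sub>n\<close> accumulate on finitely many classes only, and connectedness of the
\<open>Q\<^sub>n\<close> leaves just one.\<close>

section \<open>Monotone decompositions with Peano quotient\<close>

lemma monotone_decompD:
  assumes "monotone_decomp L D"
  shows "\<Union>D = L" "disjoint D"
    and "\<And>d. d \<in> D \<Longrightarrow> d \<noteq> {}"
    and "\<And>d. d \<in> D \<Longrightarrow> compact d"
    and "\<And>d. d \<in> D \<Longrightarrow> connected d"
    and "\<And>d U. d \<in> D \<Longrightarrow> openin (top_of_set L) U \<Longrightarrow> d \<subseteq> U \<Longrightarrow>
        \<exists>V. openin (top_of_set L) V \<and> d \<subseteq> V \<and> (\<forall>d'\<in>D. d' \<inter> V \<noteq> {} \<longrightarrow> d' \<subseteq> U)"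
  using assms unfolding monotone_decomp_def by simp_all

lemma monotone_decomp_disjnt:
  assumes "monotone_decomp L D" "d \<in> D" "e \<in> D" "d \<noteq> e"
  shows "d \<inter> e = {}"
  using monotone_decompD(2)[OF assms(1)] assms(2-4) by (simp add: disjoint_def)

text \<open>The natural projection as a function on points. The choice by \<open>THE\<close> makes
  it total; its value is meaningful on \<open>L\<close> only.\<close>

definition cls :: "R3 set set \<Rightarrow> R3 \<Rightarrow> R3 set" where
  "cls D u = (THE d. d \<in> D \<and> u \<in> d)"

lemma cls_eq:
  assumes "monotone_decomp L D" "d \<in> D" "u \<in> d"
  shows "cls D u = d"
  unfolding cls_def
proof (rule the_equality)
  fix e assume "e \<in> D \<and> u \<in> e"
  then show "e = d"
    using assms monotone_decomp_disjnt by blast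
qed (use assms in auto)

lemma cls_in:
  assumes "monotone_decomp L D" "u \<in> L"
  shows "cls D u \<in> D" "u \<in> cls D u"
proof -
  obtain d where "d \<in> D" "u \<in> d"
    using assms monotone_decompD(1) by blast
  then show "cls D u \<in> D" "u \<in> cls D u"
    using cls_eq[OF assms(1)] by auto
qed

text \<open>Disjointness of \<open>D\<close> makes unions commute with intersections: a point of
  \<open>\<Union>S\<close> and of \<open>\<Union>T\<close> lies in the same element of
  \<open>D\<close> both times. Hence the open families do form a topology.\<close>

lemma openin_decomp_topology:
  assumes "disjoint D"
  shows "openin (decomp_topology L D) \<U> \<longleftrightarrow> \<U> \<subseteq> D \<and> openin (top_of_set L) (\<Union>\<U>)"
proof -
  have eq: "d = e" if "d \<in> D" "e \<in> D" "x \<in> d" "x \<in> e" for d e x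
    using disjointD[OF assms that(1,2)] that(3,4) by blast
  have "istopology (\<lambda>\<U>. \<U> \<subseteq> D \<and> openin (top_of_set L) (\<Union>\<U>))"
    unfolding istopology_def
  proof (intro conjI allI impI)
    fix S T assume S: "S \<subseteq> D \<and> openin (top_of_set L) (\<Union>S)"
      and T: "T \<subseteq> D \<and> openin (top_of_set L) (\<Union>T)"
    have "\<Union>S \<inter> \<Union>T \<subseteq> \<Union>(S \<inter> T)"
    proof
      fix x assume "x \<in> \<Union>S \<inter> \<Union>T"
      then obtain d e where "d \<in> S" "e \<in> T" "x \<in> d" "x \<in> e" by blast
      moreover from this have "d = e" using eq S T by (meson subsetD)
      ultimately show "x \<in> \<Union>(S \<inter> T)" by blast
    qed
    then have "\<Union>(S \<inter> T) = \<Union>S \<inter> \<Union>T" by blast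
    then show "openin (top_of_set L) (\<Union>(S \<inter> T))"
      using S T by (simp add: openin_Int)
  next
    fix \<K> :: "R3 set set set"
    assume K: "\<forall>K\<in>\<K>. K \<subseteq> D \<and> openin (top_of_set L) (\<Union>K)"
    then show "\<Union>\<K> \<subseteq> D" by blast
    have "\<Union>(\<Union>\<K>) = \<Union>(Union ` \<K>)" by blast
    with K show "openin (top_of_set L) (\<Union>(\<Union>\<K>))"
      by (metis (no_types, lifting) imageE openin_Union)
  qed blast
  then show ?thesis
    unfolding decomp_topology_def by (simp add: topology_inverse')
qed

lemma topspace_decomp_topology:
  assumes "monotone_decomp L D"
  shows "topspace (decomp_topology L D) = D"
proof -
  have D: "disjoint D" "\<Union>D = L" using monotone_decompD assms by auto
  have "openin (decomp_topology L D) D"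
    using D by (simp add: openin_decomp_topology)
  moreover have "topspace (decomp_topology L D) \<subseteq> D"
    by (metis D(1) openin_decomp_topology openin_topspace)
  ultimately show ?thesis by (simp add: openin_subset subset_antisym)
qed

text \<open>Upper semicontinuity read in the quotient: the neighbourhood that it gives around an
  element inside \<open>G\<close> meets only elements inside \<open>G\<close>, and is covered by
  them because \<open>D\<close> covers \<open>L\<close>.\<close>

lemma openin_decomp_subsets:
  assumes "monotone_decomp L D" "open G"
  shows "openin (decomp_topology L D) {d \<in> D. d \<subseteq> G}"
proof -
  have D: "disjoint D" "\<Union>D = L" using monotone_decompD assms by auto
  have "\<exists>V. openin (top_of_set L) V \<and> p \<in> V \<and> V \<subseteq> \<Union>{d \<in> D. d \<subseteq> G}"
    if p: "p \<in> d" and d: "d \<in> D" "d \<subseteq> G" for p d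
  proof -
    have "openin (top_of_set L) (L \<inter> G) \<and> d \<subseteq> L \<inter> G"
      using d D(2) openin_open_Int[OF assms(2), of L] by blast
    then obtain V where V: "openin (top_of_set L) V" "d \<subseteq> V"
      "\<forall>d'\<in>D. d' \<inter> V \<noteq> {} \<longrightarrow> d' \<subseteq> L \<inter> G"
      using monotone_decompD(6)[OF assms(1) d(1)] by metis
    have "V \<subseteq> L" using V(1) openin_imp_subset by blast
    then have "V \<subseteq> \<Union>{d \<in> D. d \<subseteq> G}"
      using V(3) D(2) by blast
    then show ?thesis using V p by blast
  qed
  then have "openin (top_of_set L) (\<Union>{d \<in> D. d \<subseteq> G})"
    by (subst openin_subopen) blast
  then show ?thesis using D by (simp add: openin_decomp_topology)
qed

lemma continuous_map_cls:
  assumes "monotone_decomp L D"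
  shows "continuous_map (top_of_set L) (decomp_topology L D) (cls D)"
  unfolding continuous_map_def
proof (intro conjI allI impI)
  have D: "disjoint D" "\<Union>D = L" using monotone_decompD assms by auto
  show "cls D \<in> topspace (top_of_set L) \<rightarrow> topspace (decomp_topology L D)"
    using cls_in[OF assms] topspace_decomp_topology[OF assms] by auto
  fix \<U> assume U: "openin (decomp_topology L D) \<U>"
  then have U': "\<U> \<subseteq> D" "openin (top_of_set L) (\<Union>\<U>)"
    using openin_decomp_topology D by auto
  have "{x \<in> topspace (top_of_set L). cls D x \<in> \<U>} = \<Union>\<U>"
    using cls_in[OF assms] cls_eq[OF assms] U'(1) D(2) by (auto; blast)
  then show "openin (top_of_set L) {x \<in> topspace (top_of_set L). cls D x \<in> \<U>}"
    using U' by simp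
qed

text \<open>Here monotonicity enters. The elements of \<open>N\<close> are connected, so a
  separation of the union cuts none of them, and the elements inside \<open>A\<close> and those
  inside \<open>B\<close> would separate \<open>N\<close>.\<close>

lemma connected_Union_decomp:
  assumes "monotone_decomp L D" and N: "connectedin (decomp_topology L D) N"
  shows "connected (\<Union>N)"
  unfolding connected_def
proof (rule notI, elim exE conjE)
  fix A B assume AB: "open A" "open B" "\<Union>N \<subseteq> A \<union> B" "A \<inter> B \<inter> \<Union>N = {}"
    "A \<inter> \<Union>N \<noteq> {}" "B \<inter> \<Union>N \<noteq> {}"
  have ND: "N \<subseteq> D"
    using N topspace_decomp_topology[OF assms(1)] connectedin_subset_topspace by fastforce
  have split: "d \<subseteq> A \<or> d \<subseteq> B" if "d \<in> N" for d
  proof -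
    have "connected d" using monotone_decompD(5)[OF assms(1)] ND that by blast
    then have "A \<inter> d = {} \<or> B \<inter> d = {}"
      using connectedD[of d A B] AB that by blast
    then show ?thesis using AB(3) that by blast
  qed
  have "d \<noteq> {}" if "d \<in> N" for d
    using monotone_decompD(3)[OF assms(1)] ND that by blast
  then have "{d \<in> D. d \<subseteq> A} \<inter> {d \<in> D. d \<subseteq> B} \<inter> N = {}"
    using AB(4) by blast
  moreover have "N \<subseteq> {d \<in> D. d \<subseteq> A} \<union> {d \<in> D. d \<subseteq> B}"
    using split ND by blast
  moreover have "{d \<in> D. d \<subseteq> A} \<inter> N \<noteq> {}" "{d \<in> D. d \<subseteq> B} \<inter> N \<noteq> {}"
    using split ND AB(4-6) by blast+
  ultimately show False
    using N openin_decomp_subsets[OF assms(1) AB(1)] openin_decomp_subsets[OF assms(1) AB(2)]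
    unfolding connectedin by blast
qed

text \<open>Distinct classes are disjoint compacta, hence have disjoint open neighbourhoods. By
  upper semicontinuity these eventually contain the whole classes of \<open>u n\<close> and
  \<open>v n\<close>, which therefore cannot agree.\<close>

lemma cls_closed_relation:
  assumes D: "monotone_decomp L D" and L: "a \<in> L" "b \<in> L"
    and u: "\<And>n. u n \<in> L" "u \<longlonglongrightarrow> a" and v: "\<And>n. v n \<in> L" "v \<longlonglongrightarrow> b"
    and eq: "\<And>n. cls D (u n) = cls D (v n)"
  shows "cls D a = cls D b"
proof (rule ccontr)
  assume ne: "cls D a \<noteq> cls D b"
  note comp = monotone_decompD(4)[OF D]
  have "cls D a \<inter> cls D b = {}"
    using ne cls_in[OF D] L monotone_decomp_disjnt[OF D] by simp
  then obtain A B where AB: "open A" "open B" "cls D a \<subseteq> A" "cls D b \<subseteq> B" "A \<inter> B = {}"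
    using separation_normal_compact[OF comp[OF cls_in(1)[OF D L(1)]]
        compact_imp_closed[OF comp[OF cls_in(1)[OF D L(2)]]]] by metis
  have ev: "\<forall>\<^sub>F n in sequentially. cls D (w n) \<subseteq> G"
    if "open G" "cls D l \<subseteq> G" "l \<in> L" "\<And>n. w n \<in> L" "w \<longlonglongrightarrow> l" for w l G
  proof -
    have "limitin (decomp_topology L D) (cls D \<circ> w) (cls D l) sequentially"
      by (rule continuous_map_limit[OF continuous_map_cls[OF D]])
        (use that in \<open>simp add: limitin_subtopology\<close>)
    moreover have "cls D l \<in> {d \<in> D. d \<subseteq> G}" using that cls_in(1)[OF D] by blast
    ultimately have "\<forall>\<^sub>F n in sequentially. (cls D \<circ> w) n \<in> {d \<in> D. d \<subseteq> G}"
      using openin_decomp_subsets[OF D that(1)] unfolding limitin_def by blast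
    then show ?thesis by (rule eventually_mono) simp
  qed
  have "\<forall>\<^sub>F n in sequentially. cls D (u n) \<subseteq> A \<and> cls D (v n) \<subseteq> B"
    using ev[OF AB(1,3) L(1) u] ev[OF AB(2,4) L(2) v] by eventually_elim auto
  then obtain n where "cls D (u n) \<subseteq> A" "cls D (v n) \<subseteq> B"
    by (auto simp: eventually_sequentially)
  then show False using AB(5) eq[of n] cls_in(2)[OF D u(1)[of n]] by auto
qed

text \<open>The image of \<open>Q n\<close> in the quotient is connected, so it lies in one
  component, and for large \<open>n\<close> the diameter of that component exceeds a fixed
  \<open>c\<close>. Only finitely many components are that large, so one of them receives infinitely
  many images.\<close>

lemma peano_infinitely_many_same_component:
  assumes D: "monotone_decomp L D" and P: "peano_space (decomp_topology L D)"
    and L: "a \<in> L" "b \<in> L" and ne: "cls D a \<noteq> cls D b"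
    and u: "\<And>n. u n \<in> Q n" "u \<longlonglongrightarrow> a" and v: "\<And>n. v n \<in> Q n" "v \<longlonglongrightarrow> b"
    and Q: "\<And>n. Q n \<subseteq> L" "\<And>n. connected (Q n)"
  obtains C where "C \<in> connected_components_of (decomp_topology L D)"
    "infinite {n. cls D ` Q n \<subseteq> C}"
proof -
  let ?X = "decomp_topology L D"
  let ?cl = "cls D"
  obtain M d where Md: "Metric_space M d" and X: "Metric_space.mtopology M d = ?X"
    and fin: "\<And>c. c > 0 \<Longrightarrow> finite {C \<in> connected_components_of ?X. \<exists>x\<in>C. \<exists>y\<in>C. d x y > c}"
    using P unfolding peano_space_def by blast
  interpret Metric_space M d by (rule Md)
  have MD: "M = D" using X topspace_decomp_topology[OF D] topspace_mtopology by metis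
  \<comment> \<open>One third of the distance: when each of the two classes is moved by less than
    \<open>c\<close>, their distance stays above \<open>c\<close>.\<close>
  define c where "c = d (?cl a) (?cl b) / 3"
  have c: "c > 0" unfolding c_def using ne cls_in(1)[OF D] L MD by simp
  have lim: "\<forall>\<^sub>F n in sequentially. d (?cl l) (?cl (w n)) < c"
    if "\<And>n. w n \<in> L" "w \<longlonglongrightarrow> l" "l \<in> L" for w l
  proof -
    have "limitin ?X (?cl \<circ> w) (?cl l) sequentially"
      by (rule continuous_map_limit[OF continuous_map_cls[OF D]])
        (use that in \<open>simp add: limitin_subtopology\<close>)
    then have "\<forall>\<^sub>F n in sequentially. ?cl (w n) \<in> M \<and> d (?cl (w n)) (?cl l) < c"
      using c unfolding X[symmetric] by (simp add: limitin_metric)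
    then show ?thesis by (rule eventually_mono) (simp add: commute)
  qed
  have uv: "u n \<in> L" "v n \<in> L" for n using u(1) v(1) Q(1) by auto
  have "\<forall>\<^sub>F n in sequentially. d (?cl (u n)) (?cl (v n)) > c"
    using lim[OF uv(1) u(2) L(1)] lim[OF uv(2) v(2) L(2)]
  proof eventually_elim
    case (elim n)
    have m: "?cl a \<in> M" "?cl b \<in> M" "?cl (u n) \<in> M" "?cl (v n) \<in> M"
      using cls_in(1)[OF D] L uv MD by auto
    have "d (?cl a) (?cl b) \<le> d (?cl a) (?cl (u n)) + d (?cl (u n)) (?cl (v n)) + d (?cl (v n)) (?cl b)"
      using triangle[of "?cl a" "?cl (u n)" "?cl b"] triangle[of "?cl (u n)" "?cl (v n)" "?cl b"] m
      by simp
    then show ?case using elim commute[of "?cl (v n)" "?cl b"] unfolding c_def by simp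
  qed
  then obtain n0 where n0: "\<And>n. n \<ge> n0 \<Longrightarrow> d (?cl (u n)) (?cl (v n)) > c"
    by (auto simp: eventually_sequentially)
  let ?Fam = "{C \<in> connected_components_of ?X. \<exists>x\<in>C. \<exists>y\<in>C. d x y > c}"
  have "{n0..} \<subseteq> (\<Union>C\<in>?Fam. {n. ?cl ` Q n \<subseteq> C})"
  proof
    fix n assume "n \<in> {n0..}"
    have conn: "connectedin ?X (?cl ` Q n)"
      by (rule connectedin_continuous_map_image[OF continuous_map_cls[OF D]])
        (use Q in \<open>simp add: connectedin_subtopology\<close>)
    have "?X \<noteq> trivial_topology"
      using topspace_decomp_topology[OF D] cls_in(1)[OF D L(1)] by auto
    then obtain C where C: "C \<in> connected_components_of ?X" "?cl ` Q n \<subseteq> C"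
      using exists_connected_component_of_superset[OF conn] by metis
    moreover have "C \<in> ?Fam"
      using C n0[of n] u v \<open>n \<in> {n0..}\<close> by blast
    ultimately show "n \<in> (\<Union>C\<in>?Fam. {n. ?cl ` Q n \<subseteq> C})" by blast
  qed
  then have "infinite (\<Union>C\<in>?Fam. {n. ?cl ` Q n \<subseteq> C})"
    using infinite_Ici finite_subset by blast
  then obtain C where "C \<in> ?Fam" "infinite {n. ?cl ` Q n \<subseteq> C}"
    using fin[OF c] by blast
  then show ?thesis using that by blast
qed

text \<open>Local connectedness of \<open>C\<close> gives a connected relatively open
  \<open>N\<close> around the class of \<open>w\<close> that consists of classes inside
  \<open>G\<close>. Its union \<open>Y\<close> is connected by monotonicity, and \<open>W\<close>
  cuts out of \<open>L\<close> the union of a quotient-open family whose trace on \<open>C\<close>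
  is \<open>N\<close>.\<close>

lemma peano_connected_neighbourhood:
  assumes D: "monotone_decomp L D" and P: "peano_space (decomp_topology L D)"
    and C: "C \<in> connected_components_of (decomp_topology L D)"
    and w: "w \<in> L" "cls D w \<in> C" and G: "open G" "cls D w \<subseteq> G"
  obtains Y W where "connected Y" "Y \<subseteq> L \<inter> G" "w \<in> Y" "open W" "w \<in> W"
    "\<And>z. z \<in> W \<inter> L \<Longrightarrow> cls D z \<in> C \<Longrightarrow> z \<in> Y"
proof -
  let ?X = "decomp_topology L D"
  note dis = monotone_decompD(2,1)[OF D]
  have "locally_connected_space (subtopology ?X C)"
    using P C unfolding peano_space_def by blast
  moreover have "openin (subtopology ?X C) ({d \<in> D. d \<subseteq> G} \<inter> C)"
    using openin_decomp_subsets[OF D G(1)] by (auto simp: openin_subtopology)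
  moreover have "cls D w \<in> {d \<in> D. d \<subseteq> G} \<inter> C"
    using cls_in[OF D w(1)] w G by auto
  ultimately obtain N where N: "openin (subtopology ?X C) N" "connectedin (subtopology ?X C) N"
    "cls D w \<in> N" "N \<subseteq> {d \<in> D. d \<subseteq> G} \<inter> C"
    unfolding locally_connected_space by meson
  obtain O' where O': "openin ?X O'" "N = O' \<inter> C"
    using N(1) by (auto simp: openin_subtopology)
  then have O2: "openin (top_of_set L) (\<Union>O')" "O' \<subseteq> D"
    using openin_decomp_topology dis by auto
  then obtain W where W: "open W" "\<Union>O' = L \<inter> W"
    by (auto simp: openin_open)
  show ?thesis
  proof (rule that[of "\<Union>N" W])
    show "connected (\<Union>N)"
      using connected_Union_decomp[OF D] N(2) by (simp add: connectedin_subtopology)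
    show "\<Union>N \<subseteq> L \<inter> G" using N(4) dis(2) by blast
    show "w \<in> \<Union>N" using N(3) cls_in[OF D w(1)] by blast
    then show "w \<in> W" using O' W by blast
    show "open W" by fact
    fix z assume z: "z \<in> W \<inter> L" "cls D z \<in> C"
    then obtain e where "e \<in> O'" "z \<in> e" using W by blast
    then have "cls D z = e" using cls_eq[OF D] O2 by blast
    then show "z \<in> \<Union>N" using z \<open>e \<in> O'\<close> \<open>z \<in> e\<close> O' by blast
  qed
qed

text \<open>A relative form of boundary bumping: \<open>T\<close> plays the role of the frontier of \<open>M\<close> in \<open>L\<close>.\<close>

lemma continuum_meets_boundary_in_component:
  fixes M :: "'a::euclidean_space set"
  assumes M: "compact M" and Q: "Q \<in> components M"
    and T: "closed T" "openin (top_of_set L) (M - T)"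
    and Y: "compact Y" "connected Y" "Y \<subseteq> L" "Y \<inter> Q \<noteq> {}"
  shows "Y \<subseteq> Q \<or> Y \<inter> Q \<inter> T \<noteq> {}"
proof (rule disjCI)
  assume "\<not> Y \<inter> Q \<inter> T \<noteq> {}"
  then have YQT: "Y \<inter> T \<inter> Q = {}" by blast
  let ?F = "{H. Q \<subseteq> H \<and> openin (top_of_set M) H \<and> closedin (top_of_set M) H}"
  \<comment> \<open>The component is the intersection of the clopen sets around it. Compactness of
    \<open>Y \<inter> T\<close> then gives finitely many of them whose intersection already misses
    \<open>Y \<inter> T\<close>.\<close>
  have Qeq: "Q = \<Inter>?F" by (rule Sura_Bura_compact[OF M Q])
  have "\<exists>F'. finite F' \<and> F' \<subseteq> ?F \<and> Y \<inter> T \<inter> \<Inter>F' = {}"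
  proof (rule ccontr)
    assume "\<not> ?thesis"
    then have fip: "\<And>F'. finite F' \<Longrightarrow> F' \<subseteq> ?F \<Longrightarrow> Y \<inter> T \<inter> \<Inter>F' \<noteq> {}"
      by metis
    have "Y \<inter> T \<inter> \<Inter>?F \<noteq> {}"
    proof (rule compact_imp_fip)
      show "compact (Y \<inter> T)" using Y(1) T(1) by (rule compact_Int_closed)
      show "closed H" if "H \<in> ?F" for H
        using that closedin_compact[OF M] compact_imp_closed by blast
    qed (rule fip)
    then show False using YQT Qeq by simp
  qed
  then obtain F' where F': "finite F'" "F' \<subseteq> ?F" "Y \<inter> T \<inter> \<Inter>F' = {}" by blast
  \<comment> \<open>Inserting \<open>M\<close> keeps \<open>H\<close> inside \<open>M\<close> even
    when \<open>F'\<close> is empty.\<close>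
  define H where "H = \<Inter>(insert M F')"
  have "M \<in> ?F" using in_components_subset[OF Q] by auto
  then have F2: "insert M F' \<subseteq> ?F" using F' by blast
  then have H: "Q \<subseteq> H" "openin (top_of_set M) H" "closedin (top_of_set M) H" "H \<subseteq> M"
    unfolding H_def using F'(1)
    by (blast | intro openin_Inter | intro closedin_Inter)+
  have YHT: "Y \<inter> H \<inter> T = {}" using F'(3) unfolding H_def by blast
  have "closedin (top_of_set Y) (Y \<inter> H)"
    using H(3) M closedin_compact compact_imp_closed by (metis closedin_closed_Int)
  \<comment> \<open>Off \<open>T\<close> the set \<open>M\<close> is open in \<open>L\<close>, and
    \<open>Y \<inter> H\<close> avoids \<open>T\<close>. So openness of \<open>H\<close> in
    \<open>M\<close> becomes openness of \<open>Y \<inter> H\<close> in \<open>Y\<close>.\<close>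
  moreover have "openin (top_of_set Y) (Y \<inter> H)"
  proof -
    obtain O1 where O1: "open O1" "H = M \<inter> O1" using H(2) by (auto simp: openin_open)
    obtain O2 where O2: "open O2" "M - T = L \<inter> O2" using T(2) by (auto simp: openin_open)
    have "Y \<inter> H = Y \<inter> (O1 \<inter> O2)"
      using O1 O2 Y(3) YHT by blast
    then show ?thesis using O1(1) O2(1) by (metis open_Int openin_open_Int)
  qed
  ultimately have "Y \<inter> H = {} \<or> Y \<inter> H = Y"
    using Y(2) connected_clopen by blast
  then have "Y \<subseteq> M" using Y(4) H by blast
  then show "Y \<subseteq> Q" using components_maximal[OF Q Y(2)] Y(4) by blast
qed

text \<open>\<open>F\<close> contains every limit of points of \<open>Q n \<inter> T\<close>. A thin
  continuum around the class of \<open>l\<close> meets almost all \<open>Q n\<close> and lies inside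
  at most one of them. By boundary bumping it contains points of almost all
  \<open>Q n \<inter> T\<close>, hence one of their limits, and this limit is in
  \<open>F\<close>.\<close>

lemma cluster_class_meets:
  assumes D: "monotone_decomp L D" and P: "peano_space (decomp_topology L D)"
    and L: "compact L" and M: "compact M" "M \<subseteq> L"
    and T: "closed T" "openin (top_of_set L) (M - T)"
    and Q: "\<And>n. Q n \<in> components M" "inj Q"
    and F: "finite F"
    and lim: "\<And>r t l. strict_mono r \<Longrightarrow> (\<And>n. t n \<in> Q (r n) \<inter> T) \<Longrightarrow> t \<longlonglongrightarrow> l \<Longrightarrow> l \<in> F"
    and C: "C \<in> connected_components_of (decomp_topology L D)" "\<And>n. cls D ` Q n \<subseteq> C"
    and w: "\<And>n. w n \<in> Q n" "w \<longlonglongrightarrow> l"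
  shows "cls D l \<inter> F \<noteq> {}"
proof
  assume dis: "cls D l \<inter> F = {}"
  let ?X = "decomp_topology L D"
  have QM: "Q n \<subseteq> M" for n using Q(1) in_components_subset by blast
  have wL: "w n \<in> L" for n using QM w(1) M(2) by blast
  then have lL: "l \<in> L"
    using L w(2) closed_sequentially compact_imp_closed by blast
  have "compact (cls D l)"
    using monotone_decompD(4)[OF D] cls_in(1)[OF D lL] by blast
  then obtain G G' where G: "open G" "open G'" "cls D l \<subseteq> G" "F \<subseteq> G'" "G \<inter> G' = {}"
    using separation_normal_compact[OF _ finite_imp_closed[OF F] dis] by metis
  \<comment> \<open>The continuum used below is \<open>closure Y\<close>, which is only known to lie
    in \<open>closure G\<close>. So \<open>F\<close> has to avoid this closure.\<close>
  have GF: "closure G \<inter> F = {}"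
    using G open_Int_closure_eq_empty[of G' G] by blast
  have lC: "cls D l \<in> C"
  proof -
    have "limitin ?X (cls D \<circ> w) (cls D l) sequentially"
      by (rule continuous_map_limit[OF continuous_map_cls[OF D]])
        (use wL lL w(2) in \<open>simp add: limitin_subtopology\<close>)
    moreover have "closedin ?X C"
      using C(1) closedin_connected_components_of by blast
    moreover have "\<forall>\<^sub>F n in sequentially. (cls D \<circ> w) n \<in> C"
      using C(2) w(1) by (auto intro!: always_eventually)
    ultimately show ?thesis
      using limitin_closedin trivial_limit_sequentially by metis
  qed
  obtain Y W where Y: "connected Y" "Y \<subseteq> L \<inter> G" "l \<in> Y" "open W" "l \<in> W"
    "\<And>z. z \<in> W \<inter> L \<Longrightarrow> cls D z \<in> C \<Longrightarrow> z \<in> Y"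
    using peano_connected_neighbourhood[OF D P C(1) lL lC G(1,3)] by blast
  have Y': "closure Y \<subseteq> L" "compact (closure Y)" "connected (closure Y)" "closure Y \<subseteq> closure G"
  proof -
    show "closure Y \<subseteq> L" using Y(2) L by (meson closure_minimal compact_imp_closed le_inf_iff)
    then show "compact (closure Y)" using L
      by (meson bounded_subset closed_closure compact_eq_bounded_closed)
    show "connected (closure Y)" using connected_imp_connected_closure[OF Y(1)] .
    show "closure Y \<subseteq> closure G" using Y(2) by (intro closure_mono) blast
  qed
  have "\<forall>\<^sub>F n in sequentially. w n \<in> W"
    using w(2) Y(4,5) topological_tendstoD by blast
  then obtain n0 where n0: "\<And>n. n \<ge> n0 \<Longrightarrow> w n \<in> W"
    by (auto simp: eventually_sequentially)
  have wY: "w n \<in> closure Y" if "n \<ge> n0" for n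
    using Y(6)[of "w n"] n0[OF that] wL C(2) w(1) closure_subset by blast
  have uniq: "m = n" if "closure Y \<subseteq> Q m" "closure Y \<subseteq> Q n" for m n
  proof -
    have "Q m \<inter> Q n \<noteq> {}" using that wY[of n0] by blast
    then have "Q m = Q n" using components_nonoverlap[OF Q(1) Q(1)] by blast
    then show ?thesis using Q(2) by (simp add: inj_eq)
  qed
  \<comment> \<open>By \<open>uniq\<close> at most one index \<open>m\<close> has
    \<open>closure Y\<close> inside \<open>Q m\<close>; starting at \<open>Suc m\<close> excludes
    it.\<close>
  have "\<exists>N. \<forall>n\<ge>N. closure Y \<inter> Q n \<inter> T \<noteq> {}"
  proof -
    have bump: "closure Y \<subseteq> Q n \<or> closure Y \<inter> Q n \<inter> T \<noteq> {}" if "n \<ge> n0" for n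
      using continuum_meets_boundary_in_component[OF M(1) Q(1)[of n] T Y'(2,3,1)] wY[OF that] w(1)
      by blast
    show ?thesis
    proof (cases "\<exists>m. closure Y \<subseteq> Q m")
      case True
      then obtain m where "closure Y \<subseteq> Q m" by blast
      then have "\<forall>n\<ge>max n0 (Suc m). closure Y \<inter> Q n \<inter> T \<noteq> {}"
        using bump uniq by (metis Suc_n_not_le_n max.bounded_iff)
      then show ?thesis by blast
    qed (use bump in blast)
  qed
  then obtain N where "\<And>n. n \<ge> N \<Longrightarrow> closure Y \<inter> Q n \<inter> T \<noteq> {}" by blast
  then have "\<exists>t. t \<in> closure Y \<inter> Q (n + N) \<inter> T" for n
    by (metis all_not_in_conv le_add2)
  then obtain t where t: "\<And>n. t n \<in> closure Y \<inter> Q (n + N) \<inter> T" by metis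
  then obtain s r where sr: "s \<in> closure Y" "strict_mono r" "(t \<circ> r) \<longlonglongrightarrow> s"
    using Y'(2) unfolding compact_def by blast
  have "s \<in> F"
  proof (rule lim)
    show "strict_mono (\<lambda>n. r n + N)" using sr(2) by (simp add: strict_mono_def)
    show "(t \<circ> r) n \<in> Q (r n + N) \<inter> T" for n using t by auto
  qed (rule sr(3))
  then show False using sr(1) Y'(4) GF by blast
qed

text \<open>If the two classes differed, a subsequence of the \<open>Q n\<close> would project into
  one component \<open>C\<close>, and all its cluster points would lie in the finitely many classes
  that meet \<open>F\<close>. The class of \<open>a\<close> and the union of the others are disjoint
  compacta, and the connected \<open>Q n\<close> would finally split between their
  neighbourhoods.\<close>

proposition limit_of_components_in_one_class:
  assumes D: "monotone_decomp L D" and P: "peano_space (decomp_topology L D)"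
    and L: "compact L" and M: "compact M" "M \<subseteq> L"
    and T: "closed T" "openin (top_of_set L) (M - T)"
    and Q: "\<And>n. Q n \<in> components M" "inj Q"
    and F: "finite F"
    and lim: "\<And>r t l. strict_mono r \<Longrightarrow> (\<And>n. t n \<in> Q (r n) \<inter> T) \<Longrightarrow> t \<longlonglongrightarrow> l \<Longrightarrow> l \<in> F"
    and u: "\<And>n. u n \<in> Q n" "u \<longlonglongrightarrow> a" and v: "\<And>n. v n \<in> Q n" "v \<longlonglongrightarrow> b"
  shows "cls D a = cls D b"
proof (rule ccontr)
  assume ne: "cls D a \<noteq> cls D b"
  have QL: "Q n \<subseteq> L" for n using Q(1) in_components_subset M(2) by blast
  have Qc: "connected (Q n)" for n using Q(1) in_components_connected by blast
  have ab: "a \<in> L" "b \<in> L"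
    using L u v QL closed_sequentially compact_imp_closed by (metis subsetD)+
  obtain C where C: "C \<in> connected_components_of (decomp_topology L D)"
    "infinite {n. cls D ` Q n \<subseteq> C}"
    using peano_infinitely_many_same_component[OF D P ab ne u v QL Qc] by blast
  obtain \<sigma> :: "nat \<Rightarrow> nat" where \<sigma>: "strict_mono \<sigma>" "\<And>n. cls D ` Q (\<sigma> n) \<subseteq> C"
    using infinite_enumerate[OF C(2)] by auto
  \<comment> \<open>Stated for arbitrary further subsequences \<open>r\<close>, since below it is
    applied to cluster points found by compactness.\<close>
  have cluster: "cls D l \<inter> F \<noteq> {}"
    if r: "strict_mono r" and w: "\<And>n. w n \<in> Q (\<sigma> (r n))" "w \<longlonglongrightarrow> l" for r w l
  proof (rule cluster_class_meets[OF D P L M T _ _ F _ C(1), where Q = "\<lambda>n. Q (\<sigma> (r n))"])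
    show "inj (\<lambda>n. Q (\<sigma> (r n)))"
      using strict_mono_eq[OF \<sigma>(1)] strict_mono_eq[OF r] injD[OF Q(2)]
      by (intro injI) metis
    fix r' t l' assume "strict_mono r'" "\<And>n. t n \<in> Q (\<sigma> (r (r' n))) \<inter> T" "t \<longlonglongrightarrow> l'"
    then show "l' \<in> F"
      using lim[of "\<lambda>n. \<sigma> (r (r' n))" t l'] strict_monoD[OF \<sigma>(1)] strict_monoD[OF r]
      by (auto simp: strict_mono_def)
  qed (use Q \<sigma> w in auto)
  define E1 where "E1 = cls D a"
  define E2 where "E2 = \<Union>{d \<in> D. d \<inter> F \<noteq> {} \<and> d \<noteq> E1}"
  note cmp = monotone_decompD(4)[OF D]
  have "{d \<in> D. d \<inter> F \<noteq> {}} \<subseteq> cls D ` F"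
    using cls_eq[OF D] by blast
  then have "finite {d \<in> D. d \<inter> F \<noteq> {}}"
    using F finite_surj by blast
  then have "finite {d \<in> D. d \<inter> F \<noteq> {} \<and> d \<noteq> E1}"
    by (rule rev_finite_subset) auto
  then have E2c: "compact E2" unfolding E2_def using cmp by (intro compact_Union) auto
  have E1D: "E1 \<in> D" unfolding E1_def using cls_in(1)[OF D ab(1)] .
  have E12: "E1 \<inter> E2 = {}"
    using monotone_decomp_disjnt[OF D E1D] unfolding E2_def by blast
  obtain G1 G2 where G: "open G1" "open G2" "E1 \<subseteq> G1" "E2 \<subseteq> G2" "G1 \<inter> G2 = {}"
    using separation_normal_compact[OF cmp[OF E1D] compact_imp_closed[OF E2c] E12] by metis
  have in12: "l \<in> E1 \<union> E2"
    if "strict_mono r" "\<And>n. w n \<in> Q (\<sigma> (r n))" "w \<longlonglongrightarrow> l" for r w l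
  proof -
    have "l \<in> L" using closed_sequentially[of L w l] that QL L compact_imp_closed by blast
    then show ?thesis
      using cluster[OF that] cls_in[OF D, of l] unfolding E1_def E2_def by blast
  qed
  have "strict_mono (id :: nat \<Rightarrow> nat)" by (simp add: strict_mono_def)
  have su: "(u \<circ> \<sigma>) \<longlonglongrightarrow> a" "(v \<circ> \<sigma>) \<longlonglongrightarrow> b"
    using u v \<sigma>(1) LIMSEQ_subseq_LIMSEQ by blast+
  have "a \<in> G1" using cls_in(2)[OF D ab(1)] G E1_def by blast
  have "b \<notin> E1" using ne cls_eq[OF D E1D] E1_def by blast
  then have "b \<in> G2" using in12[OF \<open>strict_mono id\<close>, of "v \<circ> \<sigma>" b] v su G by auto
  \<comment> \<open>Otherwise points of infinitely many \<open>Q (\<sigma> n)\<close> outside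
    \<open>G1 \<union> G2\<close> would accumulate outside it, whereas all cluster points lie in
    \<open>E1 \<union> E2\<close>.\<close>
  have "\<forall>\<^sub>F n in sequentially. Q (\<sigma> n) \<subseteq> G1 \<union> G2"
  proof (rule ccontr)
    assume "\<not> ?thesis"
    then have inf: "infinite {n. \<not> Q (\<sigma> n) \<subseteq> G1 \<union> G2}"
      by (simp add: frequently_cofinite[symmetric] not_eventually cofinite_eq_sequentially)
    obtain r :: "nat \<Rightarrow> nat" where r: "strict_mono r" "\<And>n. \<not> Q (\<sigma> (r n)) \<subseteq> G1 \<union> G2"
      using infinite_enumerate[OF inf] by auto
    then have "\<exists>w. w \<in> Q (\<sigma> (r n)) - (G1 \<union> G2)" for n by blast
    then obtain w where w: "\<And>n. w n \<in> Q (\<sigma> (r n)) - (G1 \<union> G2)" by metis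
    then have "\<forall>n. w n \<in> L" using QL by blast
    then obtain l r' where l: "strict_mono r'" "(w \<circ> r') \<longlonglongrightarrow> l"
      using L unfolding compact_def by blast
    have "closed (- (G1 \<union> G2))" using G by (intro closed_Compl open_Un)
    then have "l \<in> - (G1 \<union> G2)"
      using closed_sequentially[of "- (G1 \<union> G2)" "w \<circ> r'" l] l w by auto
    moreover have "l \<in> E1 \<union> E2"
      using in12[of "\<lambda>n. r (r' n)" "w \<circ> r'"] r l w by (simp add: strict_mono_def)
    ultimately show False using G by blast
  qed
  moreover have "\<forall>\<^sub>F n in sequentially. u (\<sigma> n) \<in> G1"
    using topological_tendstoD[OF su(1) G(1) \<open>a \<in> G1\<close>] by simp
  moreover have "\<forall>\<^sub>F n in sequentially. v (\<sigma> n) \<in> G2"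
    using topological_tendstoD[OF su(2) G(2) \<open>b \<in> G2\<close>] by simp
  ultimately have "\<forall>\<^sub>F n in sequentially. False"
  proof eventually_elim
    case (elim n)
    then show ?case
      using connectedD[OF Qc[of "\<sigma> n"] G(1,2)] G(5) u(1)[of "\<sigma> n"] v(1)[of "\<sigma> n"] by blast
  qed
  then show False by simp
qed

section \<open>Disjoint continua crossing an annulus\<close>

text \<open>By Janiszewski's theorem, applied to \<open>\<alpha> \<union> X\<close> and \<open>\<beta> \<union> X\<close>, the components \<open>cA\<close> and \<open>cB\<close> of their
  complements containing \<open>W\<close> have no common point outside \<open>W\<close>. This makes \<open>Y \<inter> cA\<close> clopen in \<open>Y\<close>.\<close>

lemma continua_not_linked:
  fixes \<alpha> \<beta> X Y W :: "complex set"
  assumes comp: "compact \<alpha>" "compact \<beta>" "compact X" and "connected X" and ends: "\<alpha> \<inter> \<beta> \<subseteq> X"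
    and "connected Y" and XY: "X \<inter> Y = {}"
    and W: "W \<in> components (- (\<alpha> \<union> \<beta>))" "\<alpha> \<union> \<beta> \<subseteq> closure W"
    and XW: "X \<inter> W = {}" and YW: "Y \<inter> W = {}"
    and Y: "Y \<inter> \<alpha> \<noteq> {}" "Y \<inter> \<beta> \<noteq> {}"
  shows False
proof -
  have cW: "connected W" using W(1) in_components_connected by blast
  have WJ: "W \<inter> (\<alpha> \<union> \<beta>) = {}" using W(1) in_components_subset by blast
  obtain z0 where z0: "z0 \<in> W" using W(1) in_components_nonempty by blast
  define cA where "cA = connected_component_set (- (\<alpha> \<union> X)) z0"
  define cB where "cB = connected_component_set (- (\<beta> \<union> X)) z0"
  have op: "open cA" "open cB"
    unfolding cA_def cB_def using comp
    by (intro open_connected_component open_Compl closed_Un compact_imp_closed; simp)+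
  have sub: "cA \<inter> (\<alpha> \<union> X) = {}" "cB \<inter> (\<beta> \<union> X) = {}"
    unfolding cA_def cB_def using connected_component_subset by blast+
  \<comment> \<open>A set between \<open>W\<close> and its closure is connected. Thus the components
    \<open>cA\<close> and \<open>cB\<close> around \<open>z0\<close> reach the points of the other
    arc.\<close>
  have insW: "connected (insert y W)" if "y \<in> \<alpha> \<union> \<beta>" for y
    by (rule connected_intermediate_closure[OF cW]) (use W(2) that closure_subset in auto)
  have inA: "y \<in> cA" if "y \<in> \<beta>" "y \<notin> X" for y
  proof -
    have "insert y W \<subseteq> cA" unfolding cA_def
      by (rule connected_component_maximal) (use z0 insW that WJ XW ends in auto)
    then show ?thesis by simp
  qed
  have inB: "y \<in> cB" if "y \<in> \<alpha>" "y \<notin> X" for y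
  proof -
    have "insert y W \<subseteq> cB" unfolding cB_def
      by (rule connected_component_maximal) (use z0 insW that WJ XW ends in auto)
    then show ?thesis by simp
  qed
  have AB: "cA \<inter> cB \<subseteq> W"
  proof
    fix z assume "z \<in> cA \<inter> cB"
    then have c: "connected_component (- (\<alpha> \<union> X)) z0 z" "connected_component (- (\<beta> \<union> X)) z0 z"
      unfolding cA_def cB_def by auto
    \<comment> \<open>This makes the intersection of the two compacta connected, which is what
      Janiszewski's theorem asks for.\<close>
    have "(\<alpha> \<union> X) \<inter> (\<beta> \<union> X) = X" using ends by blast
    then have "connected_component (- ((\<alpha> \<union> X) \<union> (\<beta> \<union> X))) z0 z"
      using Janiszewski[of "\<alpha> \<union> X" "\<beta> \<union> X" z0 z] c comp \<open>connected X\<close>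
      by (simp add: compact_Un compact_imp_closed)
    then obtain T where T: "connected T" "T \<subseteq> - ((\<alpha> \<union> X) \<union> (\<beta> \<union> X))" "z0 \<in> T" "z \<in> T"
      unfolding connected_component_def by blast
    then have "T \<subseteq> W" using components_maximal[OF W(1), of T] z0 by blast
    then show "z \<in> W" using T by blast
  qed
  have "openin (top_of_set Y) (Y \<inter> cA)" using op by (simp add: openin_open_Int)
  moreover have "closedin (top_of_set Y) (Y \<inter> cA)"
  proof -
    have "openin (top_of_set Y) (Y - cA)"
    proof (subst openin_subopen, intro ballI)
      fix y assume y: "y \<in> Y - cA"
      have yX: "y \<notin> X" using y XY by blast
      show "\<exists>V. openin (top_of_set Y) V \<and> y \<in> V \<and> V \<subseteq> Y - cA"
      \<comment> \<open>A point of \<open>\<alpha>\<close> has the neighbourhood \<open>cB\<close>,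
        which meets \<open>cA\<close> only inside \<open>W\<close>, hence off \<open>Y\<close>. Any
        other point of \<open>Y - cA\<close> lies in a different component of the complement of
        \<open>\<alpha> \<union> X\<close>.\<close>
      proof (cases "y \<in> \<alpha>")
        case True
        have "Y \<inter> cB \<subseteq> Y - cA" using AB YW by blast
        then show ?thesis using inB[OF True yX] op y
          by (metis Diff_iff IntI openin_open_Int)
      next
        case False
        let ?c = "connected_component_set (- (\<alpha> \<union> X)) y"
        have "open ?c" using comp
          by (intro open_connected_component open_Compl closed_Un compact_imp_closed; simp)
        moreover have "y \<in> ?c" using False yX by simp
        moreover have "?c \<inter> cA = {}"
          using y unfolding cA_def
          by (metis DiffD2 \<open>y \<in> ?c\<close> connected_component_disjoint connected_component_eq disjoint_iff mem_Collect_eq)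
        ultimately show ?thesis using y
          by (intro exI[of _ "Y \<inter> ?c"]) (auto simp: openin_open_Int)
      qed
    qed
    then show ?thesis
      by (simp add: closedin_def Diff_Int)
  qed
  ultimately have "Y \<inter> cA = {} \<or> Y \<inter> cA = Y"
    using \<open>connected Y\<close> connected_clopen by blast
  moreover have "Y \<inter> cA \<noteq> {}" using Y(2) inA XY by blast
  moreover have "\<not> Y \<subseteq> cA" using Y(1) sub(1) by blast
  ultimately show False by blast
qed

text \<open>If the ends on \<open>g\<close> stayed apart, three of the continua would have parameters
  \<open>s i < s j < s k < t j\<close>, so that \<open>P j\<close> is linked with \<open>P i \<union> V \<union> P k\<close>, where \<open>V\<close> is the side of
  \<open>h\<close> away from \<open>U\<close>.\<close>

lemma ends_not_separated_plane:
  fixes g h :: "real \<Rightarrow> complex"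
  assumes g: "simple_path g" "pathfinish g = pathstart g"
    and h: "simple_path h" "pathfinish h = pathstart h"
    and gh: "path_image g \<inter> path_image h = {}"
    and U: "connected U" "\<not> bounded U" "U \<inter> (path_image g \<union> path_image h) = {}"
      "path_image g \<union> path_image h \<subseteq> closure U"
    and P: "\<And>n. compact (P n)" "\<And>n. connected (P n)" "\<And>n. P n \<subseteq> closure U"
      "\<And>m n. m \<noteq> n \<Longrightarrow> P m \<inter> P n = {}" "\<And>n. P n \<inter> path_image h \<noteq> {}"
    and s: "\<And>n. s n \<in> {0..1}" "\<And>n. g (s n) \<in> P n" "s \<longlonglongrightarrow> s0"
    and t: "\<And>n. t n \<in> {0..1}" "\<And>n. g (t n) \<in> P n" "t \<longlonglongrightarrow> t0"
    and less: "s0 < t0"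
  shows False
proof -
  note Jg = Jordan_inside_outside[OF g]
  note Jh = Jordan_inside_outside[OF h]
  \<comment> \<open>Being connected, unbounded and off the curve, \<open>U\<close> lies outside; the
    inside is open, so it misses the closure of \<open>U\<close> too.\<close>
  have Uin: "closure U \<inter> inside (path_image c) = {}"
    if "simple_path c" "pathfinish c = pathstart c" "U \<inter> path_image c = {}" for c :: "real \<Rightarrow> complex"
  proof -
    define I O' where "I = inside (path_image c)" and "O' = outside (path_image c)"
    have J: "open I" "open O'" "I \<inter> O' = {}" "I \<union> O' = - path_image c" "bounded I"
      using Jordan_inside_outside[OF that(1,2)] by (simp_all add: I_def O'_def)
    have sub: "U \<subseteq> I \<union> O'"
      using J(4) that(3) by blast
    then have "I \<inter> U = {} \<or> O' \<inter> U = {}"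
      using connectedD[OF U(1) J(1,2)] J(3) by blast
    moreover have "\<not> U \<subseteq> I"
      using J(5) U(2) bounded_subset by blast
    ultimately have "I \<inter> U = {}"
      using sub by blast
    then show ?thesis
      using open_Int_closure_eq_empty[OF J(1)] unfolding I_def by blast
  qed
  define W where "W = inside (path_image g)"
  define V where "V = inside (path_image h)"
  have cW: "closure U \<inter> W = {}" and cV: "closure U \<inter> V = {}"
    unfolding W_def V_def using Uin g h U(3) by blast+
  have "closure V = V \<union> path_image h" using Jh by (simp add: V_def closure_Un_frontier)
  then have V: "connected V" "path_image h \<subseteq> closure V" "V \<inter> path_image g = {}"
    using Jh cV U(4) by (simp_all add: V_def) blast
  have W5: "closure W = W \<union> path_image g" using Jg by (simp add: W_def closure_Un_frontier)
  have W: "connected W" "open W" "W \<noteq> {}" "path_image g \<subseteq> closure W"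
    "closure W = W \<union> path_image g" "bounded W" "W \<inter> path_image g = {}"
    using Jg inside_no_overlap[of "path_image g"] W5 by (simp_all add: W_def)
  \<comment> \<open>If \<open>V\<close> met \<open>W\<close>, it would lie in \<open>W\<close>, and
    \<open>h\<close> would run in \<open>closure W\<close>. As \<open>h\<close> lies in
    \<open>closure U\<close>, which misses \<open>W\<close>, it would then run in
    \<open>g\<close>.\<close>
  have VW: "V \<inter> W = {}"
  proof (rule ccontr)
    assume "V \<inter> W \<noteq> {}"
    define O' where "O' = outside (path_image g)"
    have O': "open O'" "W \<inter> O' = {}" "W \<union> O' = - path_image g"
      using Jg by (simp_all add: W_def O'_def)
    have sub: "V \<subseteq> W \<union> O'"
      using V(3) O'(3) by blast
    then have "O' \<inter> V = {}"
      using connectedD[OF V(1) W(2) O'(1)] O'(2) \<open>V \<inter> W \<noteq> {}\<close> by blast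
    then have "V \<subseteq> W" using sub by blast
    then have "path_image h \<subseteq> W \<union> path_image g"
      using V(2) W(5) closure_mono by blast
    then have "path_image h \<subseteq> path_image g" using cW U(4) by blast
    moreover have "path_image h \<noteq> {}" by simp
    ultimately show False using gh by blast
  qed
  have Wc: "W \<in> components (- path_image g)"
  proof -
    have "connected_component_set (- path_image g) z = W" if "z \<in> W" for z
    proof (rule subset_antisym)
      show "connected_component_set (- path_image g) z \<subseteq> W"
        using that unfolding W_def inside_same_component[symmetric]
        by (metis (mono_tags) inside_same_component mem_Collect_eq subsetI)
      show "W \<subseteq> connected_component_set (- path_image g) z"
        by (rule connected_component_maximal) (use that W in auto)
    qed
    then show ?thesis using W(3,7) unfolding components_def by blast
  qed
  have inj: "s m \<noteq> s n" if "m \<noteq> n" for m n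
    using P(4)[OF that] s(2)[of m] s(2)[of n] by auto
  \<comment> \<open>The midpoint separates the late \<open>s n\<close> from the late
    \<open>t n\<close>; this later yields \<open>s k < t j\<close>.\<close>
  define m where "m = (s0 + t0) / 2"
  have "s0 < m" "m < t0" using less unfolding m_def by auto
  then have "\<forall>\<^sub>F n in sequentially. s n < m \<and> m < t n"
    using order_tendstoD(2)[OF s(3)] order_tendstoD(1)[OF t(3)] eventually_conj by blast
  then obtain N where N: "\<And>n. n \<ge> N \<Longrightarrow> s n < m \<and> m < t n"
    by (auto simp: eventually_sequentially)
  \<comment> \<open>Three consecutive terms of a monotone subsequence are strictly ordered because
    the \<open>s n\<close> are distinct; a decreasing subsequence is read backwards. The shift by
    \<open>N\<close> keeps the indices beyond \<open>N\<close>.\<close>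
  obtain f :: "nat \<Rightarrow> nat" where f: "strict_mono f" "monoseq (\<lambda>n. s (f n))"
    using seq_monosub by blast
  have fN: "f (N + n) \<ge> N" for n
    using seq_suble[OF f(1), of "N + n"] by simp
  have fne: "s (f (N + a)) \<noteq> s (f (N + b))" if "a \<noteq> b" for a b
    using inj f(1) that by (metis add_left_cancel strict_mono_eq)
  have "\<exists>i j k. i \<ge> N \<and> j \<ge> N \<and> k \<ge> N \<and> s i < s j \<and> s j < s k"
  proof (cases "\<forall>m n. m \<le> n \<longrightarrow> s (f m) \<le> s (f n)")
    case True
    have "s (f (N+0)) < s (f (N+1))" "s (f (N+1)) < s (f (N+2))"
      using True fne[of 0 1] fne[of 1 2] by (simp_all add: order_less_le)
    then show ?thesis using fN by blast
  next
    case False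
    then have dec: "\<forall>m n. m \<le> n \<longrightarrow> s (f n) \<le> s (f m)"
      using f(2) unfolding monoseq_def by blast
    have "s (f (N+2)) < s (f (N+1))" "s (f (N+1)) < s (f (N+0))"
      using dec fne[of 1 0] fne[of 2 1] by (simp_all add: order_less_le)
    then show ?thesis using fN by blast
  qed
  then obtain i j k where ijk: "i \<ge> N" "j \<ge> N" "k \<ge> N" "s i < s j" "s j < s k" by blast
  then have lt: "s k < t j" using N by (meson order_less_trans)
  have ne: "i \<noteq> j" "j \<noteq> k" using ijk by auto
  obtain ci ck where c: "ci \<in> P i \<inter> path_image h" "ck \<in> P k \<inter> path_image h"
    using P(5) by blast
  \<comment> \<open>The points \<open>ci\<close> and \<open>ck\<close> on \<open>h\<close> lie in
    the closure of \<open>V\<close> and attach \<open>P i\<close> and \<open>P k\<close> to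
    it.\<close>
  have V': "connected (V \<union> {ci, ck})"
    by (rule connected_intermediate_closure[OF V(1)]) (use V(2) c closure_subset in auto)
  then have "connected (P i \<union> (V \<union> {ci, ck}) \<union> P k)"
    using c by (intro connected_Un[OF connected_Un[OF P(2) V'] P(2)]) auto
  moreover have "P i \<union> (V \<union> {ci, ck}) \<union> P k = P i \<union> V \<union> P k" using c by blast
  ultimately have Yc: "connected (P i \<union> V \<union> P k)" by simp
  \<comment> \<open>The two points of \<open>P j\<close> on \<open>g\<close> divide the loop into
    \<open>?\<alpha>\<close> and \<open>?\<beta>\<close>, which share only these points. As
    \<open>s i < s j < s k < t j\<close>, \<open>P k\<close> meets \<open>?\<alpha>\<close> and
    \<open>P i\<close> meets \<open>?\<beta>\<close>.\<close>
  let ?\<alpha> = "g ` {s j..t j}" and ?\<beta> = "g ` ({0..s j} \<union> {t j..1})"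
  have cont: "continuous_on {0..1} g"
    using g(1) unfolding simple_path_def path_def by blast
  have rng: "0 \<le> s i" "0 \<le> s j" "t j \<le> 1" "s k \<le> 1"
    using s(1) t(1) by auto
  have "{s j..t j} \<union> ({0..s j} \<union> {t j..1}) = {0..1}" using rng ijk lt by auto
  then have img: "?\<alpha> \<union> ?\<beta> = path_image g" unfolding path_image_def by (metis image_Un)
  show False
  proof (rule continua_not_linked[of ?\<alpha> ?\<beta> "P j" "P i \<union> V \<union> P k" W])
    show "compact ?\<alpha>" "compact ?\<beta>"
      using rng ijk lt
      by (intro compact_continuous_image continuous_on_subset[OF cont] compact_Un; force)+
    show "?\<alpha> \<inter> ?\<beta> \<subseteq> P j"
    proof
      fix z assume "z \<in> ?\<alpha> \<inter> ?\<beta>"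
      then obtain x y where xy: "z = g x" "z = g y" "x \<in> {s j..t j}" "y \<in> {0..s j} \<union> {t j..1}" by blast
      then have "x \<in> {0..1}" "y \<in> {0..1}" "g x = g y" using rng ijk lt by auto
      then have "x = y \<or> x = 0 \<and> y = 1 \<or> x = 1 \<and> y = 0"
        using g(1) unfolding simple_path_def loop_free_def by blast
      then have "x = s j \<or> x = t j"
        using xy(3,4) rng ijk lt by auto
      then show "z \<in> P j" using xy(1) s(2) t(2) by auto
    qed
    show "P j \<inter> (P i \<union> V \<union> P k) = {}"
      using P(3)[of j] cV P(4)[OF ne(1)] P(4)[OF ne(2)] by blast
    show "W \<in> components (- (?\<alpha> \<union> ?\<beta>))" using Wc img by simp
    show "?\<alpha> \<union> ?\<beta> \<subseteq> closure W" using W(4) img by simp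
    show "P j \<inter> W = {}" using P(3)[of j] cW by blast
    show "(P i \<union> V \<union> P k) \<inter> W = {}" using P(3)[of i] P(3)[of k] cW VW by blast
    have "g (s k) \<in> ?\<alpha>" "g (s i) \<in> ?\<beta>" using ijk lt rng by auto
    then show "(P i \<union> V \<union> P k) \<inter> ?\<alpha> \<noteq> {}" "(P i \<union> V \<union> P k) \<inter> ?\<beta> \<noteq> {}"
      using s(2)[of i] s(2)[of k] by blast+
  qed (use P Yc in auto)
qed

section \<open>Transfer from the plane to the sphere\<close>

lemma openin_component_S2:
  assumes "U \<in> components (S2 - J)" "closed J"
  shows "openin (top_of_set S2) U"
proof -
  have o: "openin (top_of_set S2) (S2 - J)"
    using assms(2) by (simp add: Diff_eq openin_open_Int open_Compl)
  have "locally connected S2"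
    unfolding S2_def by (rule locally_connected_sphere)
  then have "locally connected (S2 - J)"
    using o locally_open_subset by blast
  then have "openin (top_of_set (S2 - J)) U"
    using assms(1) openin_components_locally_connected by blast
  then show ?thesis using o openin_trans by blast
qed

lemma simple_closed_curve_nonempty:
  "simple_closed_curve J \<Longrightarrow> J \<noteq> {}" "simple_closed_curve J \<Longrightarrow> compact J"
  unfolding simple_closed_curve_def
  by (auto simp: compact_simple_path_image path_image_nonempty)

text \<open>Since \<open>U\<close> is open in the sphere, its relative frontier is
  \<open>closure U - U\<close>.\<close>

lemma is_U_D:
  assumes "simple_closed_curve J1" "simple_closed_curve J2" "is_U J1 J2 U"
  shows "openin (top_of_set S2) U" "connected U" "U \<noteq> {}" "U \<inter> (J1 \<union> J2) = {}"
    "J1 \<union> J2 \<subseteq> closure U" "closure U \<subseteq> U \<union> (J1 \<union> J2)"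
proof -
  have U: "U \<in> components (S2 - (J1 \<union> J2))" and fr: "(top_of_set S2) frontier_of U = J1 \<union> J2"
    using assms(3) unfolding is_U_def by auto
  show op: "openin (top_of_set S2) U"
    using openin_component_S2[OF U] simple_closed_curve_nonempty(2) assms(1,2) compact_imp_closed
    by blast
  show "connected U" "U \<noteq> {}" "U \<inter> (J1 \<union> J2) = {}"
    using U in_components_connected in_components_nonempty in_components_subset by blast+
  have US: "U \<subseteq> S2" using op openin_imp_subset by blast
  have cS: "closure U \<subseteq> S2"
    by (rule closure_minimal) (use US in \<open>simp_all add: S2_def\<close>)
  have "(top_of_set S2) closure_of U = closure U"
    using US cS by (auto simp: closure_of_subtopology Int_absorb1)
  then have "J1 \<union> J2 = closure U - U"
    using fr op unfolding frontier_of_def by (simp add: interior_of_openin)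
  then show "J1 \<union> J2 \<subseteq> closure U" "closure U \<subseteq> U \<union> (J1 \<union> J2)"
    by auto
qed

lemma punctured_S2_homeomorphic_plane:
  assumes "p \<in> S2"
  obtains h k where "homeomorphism (S2 - {p}) (UNIV :: complex set) h k"
proof -
  have "rel_frontier (cball 0 1 :: R3 set) - {p} homeomorphic (UNIV :: complex set)"
  proof (rule homeomorphic_punctured_sphere_affine_gen)
    show "p \<in> rel_frontier (cball 0 1)"
      using assms by (simp add: S2_def)
    show "aff_dim (cball 0 1 :: R3 set) = aff_dim (UNIV :: complex set) + 1"
      by (simp add: aff_dim_cball)
  qed auto
  then show ?thesis using that unfolding homeomorphic_def S2_def by auto
qed

text \<open>Removing the antipode of \<open>p\<close> leaves a copy of the plane, which has no
  isolated points.\<close>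

lemma not_openin_S2_singleton: "\<not> openin (top_of_set S2) {p}"
proof
  assume p: "openin (top_of_set S2) {p}"
  then have pS: "p \<in> S2" using openin_imp_subset by blast
  have "p \<noteq> - p"
  proof
    assume "p = - p"
    then have "2 *\<^sub>R p = 0" by (metis add.right_inverse scaleR_2)
    then show False using pS unfolding S2_def by simp
  qed
  then have e: "- p \<in> S2" "p \<noteq> - p" using pS unfolding S2_def by simp_all
  obtain h k where hk: "homeomorphism (S2 - {- p}) (UNIV :: complex set) h k"
    using punctured_S2_homeomorphic_plane[OF e(1)] by blast
  have "openin (top_of_set (S2 - {- p})) {p}"
    by (rule openin_subset_trans[OF p]) (use e pS in auto)
  then have "openin (top_of_set UNIV) (h ` {p})"
    using hk homeomorphism_imp_open_map by blast
  then show False by (simp add: not_open_singleton)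
qed

text \<open>The chart that sends \<open>e\<close> to infinity maps \<open>U\<close> onto a connected
  open subset of the plane, and deleting a point from such a set keeps it connected.\<close>

lemma connected_delete_S2:
  assumes U: "openin (top_of_set S2) U" "connected U" and e: "e \<in> S2" "e \<notin> U"
  shows "connected (U - {p})"
proof -
  obtain h k where hk: "homeomorphism (S2 - {e}) (UNIV :: complex set) h k"
    using punctured_S2_homeomorphic_plane[OF e(1)] by blast
  have sub: "U \<subseteq> S2 - {e}" using U(1) e openin_imp_subset by blast
  then have "openin (top_of_set (S2 - {e})) U"
    using U(1) openin_subset_trans by blast
  then have "open (h ` U)"
    using homeomorphism_imp_open_map[OF hk, of U] by simp
  moreover have "connected (h ` U)"
    by (rule connected_continuous_image[OF continuous_on_subset[OF homeomorphism_cont1[OF hk] sub] U(2)])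
  ultimately have "connected (h ` U - {h p})"
    by (rule connected_open_delete) simp
  then have "connected (k ` (h ` U - {h p}))"
    by (rule connected_continuous_image[OF continuous_on_subset[OF homeomorphism_cont2[OF hk] subset_UNIV]])
  moreover have "k ` (h ` U - {h p}) = U - {p}" if "p \<in> U"
  proof -
    have inj: "inj_on h U" using homeomorphism_apply1[OF hk] sub by (metis inj_onI subsetD)
    have "h ` U - {h p} = h ` (U - {p})" using inj_on_image_set_diff[OF inj, of U "{p}"] that by auto
    moreover have "k ` h ` (U - {p}) = U - {p}"
      using homeomorphism_apply1[OF hk] sub by (force simp: image_image)
    ultimately show ?thesis by simp
  qed
  ultimately show ?thesis using U(2) by (cases "p \<in> U") auto
qed

text \<open>Sending a point \<open>p\<close> of \<open>U\<close> to infinity turns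
  \<open>U - {p}\<close> into an unbounded plane region with both curves in its closure. If the
  limits differed, so would the limits of the parameters along a subsequence, which the planar
  statement forbids.\<close>

lemma ends_not_separated_S2:
  assumes J: "simple_closed_curve J1" "simple_closed_curve J2" "J1 \<inter> J2 = {}" and U: "is_U J1 J2 U"
    and P: "\<And>n. compact (P n)" "\<And>n. connected (P n)" "\<And>n. P n \<subseteq> closure U"
      "\<And>m n. m \<noteq> n \<Longrightarrow> P m \<inter> P n = {}" "\<And>n. P n \<inter> J2 \<noteq> {}"
    and a: "\<And>n. a n \<in> P n \<inter> J1" "a \<longlonglongrightarrow> a0"
    and b: "\<And>n. b n \<in> P n \<inter> J1" "b \<longlonglongrightarrow> b0"
  shows "a0 = b0"
proof (rule ccontr)
  assume ne: "a0 \<noteq> b0"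
  note UD = is_U_D[OF J(1,2) U]
  obtain g1 where g1: "simple_path g1" "pathfinish g1 = pathstart g1" "path_image g1 = J1"
    using J(1) unfolding simple_closed_curve_def by blast
  obtain g2 where g2: "simple_path g2" "pathfinish g2 = pathstart g2" "path_image g2 = J2"
    using J(2) unfolding simple_closed_curve_def by blast
  have JS: "J1 \<subseteq> S2" "J2 \<subseteq> S2" using J unfolding simple_closed_curve_def by auto
  have US: "U \<subseteq> S2" using UD(1) openin_imp_subset by blast
  obtain p where p: "p \<in> U" using UD(3) by blast
  then have pS: "p \<in> S2" using US by blast
  obtain h k where hk: "homeomorphism (S2 - {p}) (UNIV :: complex set) h k"
    using punctured_S2_homeomorphic_plane[OF pS] by blast
  then have ch: "continuous_on (S2 - {p}) h" and kh: "\<And>x. x \<in> S2 - {p} \<Longrightarrow> k (h x) = x"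
    and ck: "continuous_on UNIV k" and kS: "\<And>z. k z \<in> S2 - {p}"
    unfolding homeomorphism_def by auto
  have ih: "inj_on h (S2 - {p})" using kh by (metis inj_onI)
  have J': "J1 \<subseteq> S2 - {p}" "J2 \<subseteq> S2 - {p}" using JS UD(4) p by auto
  let ?V = "h ` (U - {p})"
  obtain e where e: "e \<in> J1" using simple_closed_curve_nonempty(1)[OF J(1)] by blast
  have "connected (U - {p})"
    using connected_delete_S2[OF UD(1,2), of e] e JS UD(4) by blast
  then have V1: "connected ?V"
    by (intro connected_continuous_image continuous_on_subset[OF ch]) (use US in auto)
  have cl: "h ` (closure U - {p}) \<subseteq> closure ?V" if "closure U \<subseteq> S2"
  proof
    fix z assume "z \<in> h ` (closure U - {p})"
    then obtain x where x: "x \<in> closure U" "x \<noteq> p" "z = h x" by blast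
    have "closure U = closure (U - {p}) \<union> {p}"
      using closure_Un[of "U - {p}" "{p}"] p by (simp add: insert_absorb)
    then have "x \<in> closure (U - {p})" using x by blast
    then obtain f where f: "\<And>n. f n \<in> U - {p}" "f \<longlonglongrightarrow> x"
      using closure_sequential by metis
    have "(h \<circ> f) \<longlonglongrightarrow> h x"
      using ch[unfolded continuous_on_sequentially] f x US that by blast
    then show "z \<in> closure ?V"
      unfolding x(3) closure_sequential using f by (intro exI[of _ "h \<circ> f"]) auto
  qed
  have cU: "closure U \<subseteq> S2" using UD(6) JS US by blast
  note cl = cl[OF cU]
  \<comment> \<open>If the image were bounded, \<open>k\<close> would map its closure to a compact
    set containing \<open>U - {p}\<close> but not \<open>p\<close>, and \<open>p\<close> would be
    isolated in the sphere.\<close>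
  have V2: "\<not> bounded ?V"
  proof
    assume "bounded ?V"
    then have "compact (k ` closure ?V)"
      by (intro compact_continuous_image continuous_on_subset[OF ck]) (auto simp: compact_closure)
    then have c: "closed (k ` closure ?V)" by (rule compact_imp_closed)
    have "U - {p} \<subseteq> k ` closure ?V"
    proof
      fix x assume x: "x \<in> U - {p}"
      have "h x \<in> closure ?V" by (rule subsetD[OF closure_subset imageI[OF x]])
      moreover have "x = k (h x)" using kh[of x] x US by auto
      ultimately show "x \<in> k ` closure ?V" by (rule rev_image_eqI)
    qed
    moreover have "p \<notin> k ` closure ?V" using kS by auto
    ultimately have "U \<inter> - k ` closure ?V = {p}" using p by blast
    then have "openin (top_of_set S2) {p}"
      using UD(1) c by (metis open_Compl openin_Int_open)
    then show False using not_openin_S2_singleton by blast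
  qed
  have loops: "simple_path (h \<circ> g)" "pathfinish (h \<circ> g) = pathstart (h \<circ> g)" "path_image (h \<circ> g) = h ` path_image g"
    if "simple_path g" "pathfinish g = pathstart g" "path_image g \<subseteq> S2 - {p}" for g
    using that simple_path_continuous_image[of g h] ch ih
    by (auto simp: pathfinish_compose pathstart_compose path_image_compose
        intro: continuous_on_subset inj_on_subset)
  \<comment> \<open>The \<open>P n\<close> are disjoint, so at most one of them contains
    \<open>p\<close>; the shift by \<open>N\<close> drops it.\<close>
  have "\<exists>N. \<forall>n\<ge>N. p \<notin> P n"
  proof (cases "\<exists>m. p \<in> P m")
    case True
    then obtain m where "p \<in> P m" by blast
    then have "\<forall>n\<ge>Suc m. p \<notin> P n" using P(4) by (metis disjoint_iff Suc_n_not_le_n)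
    then show ?thesis by blast
  qed blast
  then obtain N where N: "\<And>n. n \<ge> N \<Longrightarrow> p \<notin> P n" by blast
  have PS: "P (n + N) \<subseteq> S2 - {p}" for n using P(3)[of "n + N"] cU N[of "n + N"] by auto
  have "a (n + N) \<in> g1 ` {0..1}" for n
    using a(1)[of "n + N"] g1(3) unfolding path_image_def by simp
  then obtain s where s: "\<And>n. s n \<in> {0..1}" "\<And>n. g1 (s n) = a (n + N)"
    unfolding image_iff by metis
  have "b (n + N) \<in> g1 ` {0..1}" for n
    using b(1)[of "n + N"] g1(3) unfolding path_image_def by simp
  then obtain t where t: "\<And>n. t n \<in> {0..1}" "\<And>n. g1 (t n) = b (n + N)"
    unfolding image_iff by metis
  have comp01: "compact ({0..1} \<times> {0..1} :: (real \<times> real) set)" by (intro compact_Times) auto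
  have "\<forall>n. (s n, t n) \<in> {0..1} \<times> {0..1}" using s t by auto
  then obtain l r where l: "l \<in> {0..1} \<times> {0..1}" "strict_mono r" "((\<lambda>n. (s n, t n)) \<circ> r) \<longlonglongrightarrow> l"
    using comp01[unfolded compact_def, rule_format, of "\<lambda>n. (s n, t n)"] by blast
  obtain s0 t0 where st: "l = (s0, t0)" by (cases l)
  have lim: "(\<lambda>n. s (r n)) \<longlonglongrightarrow> s0" "(\<lambda>n. t (r n)) \<longlonglongrightarrow> t0"
    using tendsto_fst[OF l(3)] tendsto_snd[OF l(3)] unfolding st o_def by auto
  have cg: "continuous_on {0..1} g1" using g1(1) unfolding simple_path_def path_def by blast
  have rN: "strict_mono (\<lambda>n. r n + N)" using l(2) by (simp add: strict_mono_def)
  have "(\<lambda>n. g1 (s (r n))) \<longlonglongrightarrow> g1 s0"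
    using cg[unfolded continuous_on_sequentially] lim(1) l(1) s(1) unfolding st o_def by auto
  then have "g1 s0 = a0"
    using LIMSEQ_subseq_LIMSEQ[OF a(2) rN] LIMSEQ_unique unfolding s(2) o_def by blast
  have "(\<lambda>n. g1 (t (r n))) \<longlonglongrightarrow> g1 t0"
    using cg[unfolded continuous_on_sequentially] lim(2) l(1) t(1) unfolding st o_def by auto
  then have "g1 t0 = b0"
    using LIMSEQ_subseq_LIMSEQ[OF b(2) rN] LIMSEQ_unique unfolding t(2) o_def by blast
  have "s0 \<noteq> t0" using \<open>g1 s0 = a0\<close> \<open>g1 t0 = b0\<close> ne by auto
  let ?P = "\<lambda>n. h ` P (r n + N)"
  \<comment> \<open>Kept general in the parameter sequences, so that the roles of \<open>a\<close>
    and \<open>b\<close> can be exchanged when \<open>t0 < s0\<close>.\<close>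
  have *: False
    if "\<And>n. s' n \<in> {0..1}" "\<And>n. g1 (s' n) \<in> P (r n + N)" "s' \<longlonglongrightarrow> s0'"
      "\<And>n. t' n \<in> {0..1}" "\<And>n. g1 (t' n) \<in> P (r n + N)" "t' \<longlonglongrightarrow> t0'" "s0' < t0'"
    for s' t' s0' t0'
  proof (rule ends_not_separated_plane[of "h \<circ> g1" "h \<circ> g2" ?V ?P s' s0' t' t0'])
    note l1 = loops[OF g1(1,2)] and l2 = loops[OF g2(1,2)]
    show "simple_path (h \<circ> g1)" "pathfinish (h \<circ> g1) = pathstart (h \<circ> g1)"
      "simple_path (h \<circ> g2)" "pathfinish (h \<circ> g2) = pathstart (h \<circ> g2)"
      using l1 l2 g1 g2 J' by auto
    have im: "path_image (h \<circ> g1) = h ` J1" "path_image (h \<circ> g2) = h ` J2"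
      using l1 l2 g1 g2 J' by auto
    show "path_image (h \<circ> g1) \<inter> path_image (h \<circ> g2) = {}"
      unfolding im using inj_on_image_Int[OF ih J'] J(3) by auto
    have "h ` (U - {p}) \<inter> h ` (J1 \<union> J2) = h ` ((U - {p}) \<inter> (J1 \<union> J2))"
      by (rule inj_on_image_Int[OF ih, symmetric]) (use US J' in auto)
    then show "?V \<inter> (path_image (h \<circ> g1) \<union> path_image (h \<circ> g2)) = {}"
      unfolding im image_Un[symmetric] using UD(4) by auto
    have "h ` (J1 \<union> J2) \<subseteq> h ` (closure U - {p})" using UD(5) J' by blast
    then show "path_image (h \<circ> g1) \<union> path_image (h \<circ> g2) \<subseteq> closure ?V"
      unfolding im image_Un[symmetric] using cl by blast
    fix n
    show "compact (?P n)" "connected (?P n)"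
      by (intro compact_continuous_image connected_continuous_image continuous_on_subset[OF ch] P PS)+
    have "P (r n + N) \<subseteq> closure U - {p}" using P(3) PS by blast
    then show "?P n \<subseteq> closure ?V" using cl by blast
    show "?P n \<inter> path_image (h \<circ> g2) \<noteq> {}" unfolding im using P(5)[of "r n + N"] by blast
    show "(h \<circ> g1) (s' n) \<in> ?P n" "(h \<circ> g1) (t' n) \<in> ?P n" using that by auto
    fix m :: nat assume "m \<noteq> n"
    then have "r m + N \<noteq> r n + N" using strict_mono_eq[OF l(2)] by simp
    then show "?P m \<inter> ?P n = {}"
      using P(4) inj_on_image_Int[OF ih PS PS] by (metis image_empty)
  qed (use that V1 V2 in auto)
  consider "s0 < t0" | "t0 < s0" using \<open>s0 \<noteq> t0\<close> by linarith
  then show False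
  proof cases
    case 1
    show False
      by (rule *[of "\<lambda>n. s (r n)" s0 "\<lambda>n. t (r n)" t0]) (use s t a b lim 1 in auto)
  next
    case 2
    show False
      by (rule *[of "\<lambda>n. t (r n)" t0 "\<lambda>n. s (r n)" s0]) (use s t a b lim 2 in auto)
  qed
qed

section \<open>Openness and fibres of rational maps\<close>

text \<open>Stereographic projection. At \<open>north\<close> it takes the default value 0, from
  division by zero.\<close>

definition stereo_inv :: "R3 \<Rightarrow> complex" where
  "stereo_inv = (\<lambda>(x, y, t). Complex (x / (1 - t)) (y / (1 - t)))"

text \<open>The conjugate of \<open>z \<mapsto> 1 / z\<close> under stereographic projection.\<close>

definition sphere_inversion :: "R3 \<Rightarrow> R3" where
  "sphere_inversion = (\<lambda>(x, y, t). (x, - y, - t))"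

lemma S2_iff: "(x, y, t) \<in> S2 \<longleftrightarrow> x\<^sup>2 + y\<^sup>2 + t\<^sup>2 = 1"
  by (simp add: S2_def norm_prod_def add.assoc)

lemma stereo_in_S2: "stereo z \<in> S2"
proof -
  define c where "c = (cmod z)\<^sup>2"
  have c: "c \<ge> 0" "(Re z)\<^sup>2 + (Im z)\<^sup>2 = c" unfolding c_def by (simp_all add: cmod_power2)
  have "(2 * Re z)\<^sup>2 + (2 * Im z)\<^sup>2 + (c - 1)\<^sup>2 = (c + 1)\<^sup>2"
    using c(2) by (simp add: power2_eq_square algebra_simps)
  moreover have "c + 1 \<noteq> 0" using c(1) by simp
  ultimately show ?thesis
    unfolding stereo_def S2_iff c_def[symmetric] power_divide
    by (simp add: add_divide_distrib[symmetric])
qed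

lemma stereo_ne_north: "stereo z \<noteq> north"
proof
  assume "stereo z = north"
  then have "((cmod z)\<^sup>2 - 1) / ((cmod z)\<^sup>2 + 1) = 1" by (simp add: stereo_def north_def)
  moreover have "(cmod z)\<^sup>2 + 1 \<noteq> 0" by (metis add_nonneg_eq_0_iff zero_le_one zero_le_power2 zero_neq_one)
  ultimately show False by (simp add: field_simps)
qed

lemma stereo_inv_stereo: "stereo_inv (stereo z) = z"
proof -
  define c where "c = (cmod z)\<^sup>2"
  have c: "c + 1 \<noteq> 0" unfolding c_def by (metis add_nonneg_eq_0_iff zero_le_one zero_le_power2 zero_neq_one)
  then have d: "1 - (c - 1) / (c + 1) = 2 / (c + 1)" by (simp add: field_simps)
  have e: "2 * x / k / (2 / k) = x" if "k \<noteq> 0" for x k :: real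
    using that by simp
  have "stereo_inv (stereo z) = Complex (2 * Re z / (c + 1) / (2 / (c + 1))) (2 * Im z / (c + 1) / (2 / (c + 1)))"
    unfolding d[symmetric] by (simp only: stereo_inv_def stereo_def c_def prod.case)
  also have "\<dots> = Complex (Re z) (Im z)" unfolding e[OF c] ..
  finally show ?thesis by simp
qed

lemma stereo_stereo_inv:
  assumes "u \<in> S2" "u \<noteq> north"
  shows "stereo (stereo_inv u) = u"
proof -
  obtain x y t where u: "u = (x, y, t)" by (cases u)
  have s: "x\<^sup>2 + y\<^sup>2 + t\<^sup>2 = 1" using assms(1) u S2_iff by simp
  have t: "1 - t \<noteq> 0"
  proof
    assume "1 - t = 0"
    then have "t = 1" by simp
    then have "x\<^sup>2 + y\<^sup>2 = 0" using s by simp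
    then have "x = 0" "y = 0" by (auto simp: sum_power2_eq_zero_iff)
    then show False using assms(2) u \<open>t = 1\<close> by (simp add: north_def)
  qed
  let ?z = "stereo_inv u"
  have z: "Re ?z = x / (1 - t)" "Im ?z = y / (1 - t)" by (simp_all add: u stereo_inv_def)
  have "(cmod ?z)\<^sup>2 = (x\<^sup>2 + y\<^sup>2) / (1 - t)\<^sup>2"
    by (simp add: cmod_power2 z power_divide add_divide_distrib)
  also have "\<dots> = (1 + t) * (1 - t) / (1 - t)\<^sup>2"
    using s by (simp add: algebra_simps power2_eq_square)
  also have "\<dots> = (1 + t) / (1 - t)" using t by (simp add: power2_eq_square)
  finally have c: "(cmod ?z)\<^sup>2 = (1 + t) / (1 - t)" .
  have "(cmod ?z)\<^sup>2 + 1 = 2 / (1 - t)" "(cmod ?z)\<^sup>2 - 1 = 2 * t / (1 - t)"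
    unfolding c using t by (simp_all add: field_simps)
  then show ?thesis
    unfolding stereo_def z using t u by simp
qed

lemma S2_eq: "S2 = insert north (range stereo)"
proof -
  have "north \<in> S2" by (simp add: north_def S2_iff)
  then show ?thesis using stereo_in_S2 stereo_stereo_inv by (metis (no_types, opaque_lifting) image_subset_iff insertCI insertE insert_subset rangeI subsetI subset_antisym)
qed

lemma continuous_on_stereo: "continuous_on A stereo"
proof -
  have "(cmod z)\<^sup>2 + 1 \<noteq> 0" for z by (metis add_nonneg_eq_0_iff zero_le_one zero_le_power2 zero_neq_one)
  then show ?thesis unfolding stereo_def by (intro continuous_intros) auto
qed

lemma continuous_on_stereo_inv: "continuous_on (S2 - {north}) stereo_inv"
proof -
  have "snd (snd u) \<noteq> 1" if u: "u \<in> S2 - {north}" for u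
  proof
    assume t: "snd (snd u) = 1"
    obtain z where "u = stereo z" using u unfolding S2_eq by blast
    then have "((cmod z)\<^sup>2 - 1) / ((cmod z)\<^sup>2 + 1) = 1" using t by (simp add: stereo_def)
    moreover have "(cmod z)\<^sup>2 + 1 \<noteq> 0" by (metis add_nonneg_eq_0_iff zero_le_one zero_le_power2 zero_neq_one)
    ultimately show False by (simp add: field_simps)
  qed
  then have "continuous_on (S2 - {north})
      (\<lambda>u. Complex (fst u / (1 - snd (snd u))) (fst (snd u) / (1 - snd (snd u))))"
    unfolding Complex_eq by (intro continuous_intros) auto
  then show ?thesis by (simp add: stereo_inv_def case_prod_beta)
qed

lemma homeomorphism_stereo: "homeomorphism UNIV (S2 - {north}) stereo stereo_inv"
proof (rule homeomorphismI)
  show "stereo ` UNIV \<subseteq> S2 - {north}" 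
    by (rule image_subsetI) (simp add: stereo_in_S2 stereo_ne_north)
  show "stereo (stereo_inv u) = u" if "u \<in> S2 - {north}" for u
    using that stereo_stereo_inv by simp
qed (simp_all add: continuous_on_stereo continuous_on_stereo_inv stereo_inv_stereo)

lemma openin_stereo_image:
  assumes "open V"
  shows "openin (top_of_set S2) (stereo ` V)"
proof -
  have "openin (top_of_set (S2 - {north})) (stereo ` V)"
    using homeomorphism_imp_open_map[OF homeomorphism_stereo, of V] assms by simp
  moreover have "openin (top_of_set S2) (S2 - {north})"
    by (simp add: Diff_eq openin_open_Int open_Compl)
  ultimately show ?thesis using openin_trans by blast
qed

lemma open_stereo_vimage:
  assumes "openin (top_of_set S2) G"
  shows "open (stereo -` G)"
proof -
  obtain O' where "open O'" "G = S2 \<inter> O'" using assms by (auto simp: openin_open)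
  moreover have "stereo -` (S2 \<inter> O') = stereo -` O'" using stereo_in_S2 by auto
  ultimately show ?thesis
    using continuous_on_stereo[of UNIV] open_vimage by metis
qed

lemma sphere_inversion_simps:
  "sphere_inversion (sphere_inversion u) = u"
  "sphere_inversion u \<in> S2 \<longleftrightarrow> u \<in> S2"
  "sphere_inversion north = stereo 0"
  by (cases u; simp add: sphere_inversion_def S2_iff north_def stereo_def)+

lemma continuous_on_sphere_inversion: "continuous_on A sphere_inversion"
  unfolding sphere_inversion_def case_prod_beta by (intro continuous_intros)

lemma sphere_inversion_stereo:
  assumes "z \<noteq> 0"
  shows "sphere_inversion (stereo z) = stereo (inverse z)"
proof -
  define c where "c = (cmod z)\<^sup>2"
  have c: "c > 0" unfolding c_def using assms by simp
  have i: "(cmod (inverse z))\<^sup>2 = 1 / c" by (simp add: c_def norm_inverse power_inverse divide_inverse)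
  have ri: "Re (inverse z) = Re z / c" "Im (inverse z) = - Im z / c"
    unfolding c_def by (simp_all add: cmod_power2)
  have k: "1 / c + 1 = (c + 1) / c" "1 / c - 1 = (1 - c) / c"
    using c by (simp_all add: field_simps)
  have cancel: "x / c / ((c + 1) / c) = x / (c + 1)" for x
    using c by simp
  have "stereo (inverse z) = (2 * Re z / c / ((c + 1) / c), - (2 * Im z) / c / ((c + 1) / c), (1 - c) / c / ((c + 1) / c))"
    unfolding stereo_def i ri k by simp
  also have "\<dots> = sphere_inversion (stereo z)"
  proof -
    have "(1 - c) / (c + 1) = - ((c - 1) / (c + 1))"
      by (metis minus_diff_eq minus_divide_left)
    then show ?thesis
      unfolding cancel stereo_def sphere_inversion_def c_def[symmetric] by simp
  qed
  finally show ?thesis by simp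
qed

lemma openin_sphere_inversion_image:
  assumes "openin (top_of_set S2) G"
  shows "openin (top_of_set S2) (sphere_inversion ` G)"
proof -
  have "homeomorphism S2 S2 sphere_inversion sphere_inversion"
    by (rule homeomorphismI)
      (auto simp: sphere_inversion_simps continuous_on_sphere_inversion)
  then show ?thesis using assms homeomorphism_imp_open_map by blast
qed

text \<open>A form of being a nonconstant rational map that survives inversion in source or target:
  neither polynomial is a multiple of the other, and the formula may fail on a finite set.
  Coprimality, which is used only at single points, is kept apart.\<close>

definition represents :: "(R3 \<Rightarrow> R3) \<Rightarrow> complex poly \<Rightarrow> complex poly \<Rightarrow> bool" where
  "represents F p q \<longleftrightarrow> continuous_on S2 F \<and> F ` S2 \<subseteq> S2 \<and>
     (\<forall>c. p \<noteq> smult c q) \<and> (\<forall>c. q \<noteq> smult c p) \<and>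
     (\<exists>E. finite E \<and> (\<forall>z. z \<notin> E \<longrightarrow> F (stereo z) = stereo (poly p z / poly q z)))"

lemma representsD:
  assumes "represents F p q"
  shows "continuous_on S2 F" "F ` S2 \<subseteq> S2" "p \<noteq> 0" "q \<noteq> 0" "\<And>c. p \<noteq> smult c q" "\<And>c. q \<noteq> smult c p"
  using assms unfolding represents_def by (auto; metis smult_0_left)+

text \<open>Both sides are continuous at \<open>z0\<close> and agree on a punctured neighbourhood,
  because the exceptional set is finite.\<close>

lemma represents_eq:
  assumes "represents F p q" and z0: "poly q z0 \<noteq> 0"
  shows "F (stereo z0) = stereo (poly p z0 / poly q z0)"
proof -
  obtain E where E: "finite E" "\<And>z. z \<notin> E \<Longrightarrow> F (stereo z) = stereo (poly p z / poly q z)"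
    using assms(1) unfolding represents_def by blast
  have "continuous_on UNIV (F \<circ> stereo)"
    using representsD(1)[OF assms(1)] stereo_in_S2
    by (intro continuous_on_compose continuous_on_stereo) (auto intro: continuous_on_subset)
  then have lim1: "((F \<circ> stereo) \<longlongrightarrow> F (stereo z0)) (at z0)"
    by (metis UNIV_I comp_apply continuous_on_def)
  have "continuous (at (poly p z0 / poly q z0)) stereo"
    using continuous_on_stereo[of UNIV] by (simp add: continuous_on_eq_continuous_at)
  then have lim2: "((\<lambda>z. stereo (poly p z / poly q z)) \<longlongrightarrow> stereo (poly p z0 / poly q z0)) (at z0)"
    using z0 by (intro isCont_tendsto_compose[of _ stereo] tendsto_intros poly_isCont[unfolded isCont_def])
  have "\<forall>\<^sub>F z in at z0. z \<notin> E"
    using E(1) islimpt_finite[of E z0] unfolding islimpt_iff_eventually by auto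
  then have "\<forall>\<^sub>F z in at z0. (F \<circ> stereo) z = stereo (poly p z / poly q z)"
    by (rule eventually_mono) (simp add: E(2))
  then show ?thesis
    using tendsto_unique[OF _ Lim_transform_eventually[OF lim1] lim2] by simp
qed

text \<open>Openness at one point, so that ordinary points, poles and \<open>north\<close> can be
  treated in different charts.\<close>

definition locally_open_at :: "(R3 \<Rightarrow> R3) \<Rightarrow> R3 \<Rightarrow> bool" where
  "locally_open_at F u \<longleftrightarrow> (\<forall>G. openin (top_of_set S2) G \<and> u \<in> G \<longrightarrow>
     (\<exists>H. openin (top_of_set S2) H \<and> F u \<in> H \<and> H \<subseteq> F ` G))"

text \<open>The open mapping theorem in the chart. The quotient is not constant on a ball, since
  \<open>p - smult c q\<close> is nonzero and has finitely many roots.\<close>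

lemma represents_open_at_nonpole:
  assumes F: "represents F p q" and z0: "poly q z0 \<noteq> 0"
  shows "locally_open_at F (stereo z0)"
  unfolding locally_open_at_def
proof (intro allI impI, elim conjE)
  fix G assume G: "openin (top_of_set S2) G" "stereo z0 \<in> G"
  have "open (stereo -` G \<inter> {z. poly q z \<noteq> 0})"
    by (intro open_Int[OF open_stereo_vimage[OF G(1)]] open_Collect_neq continuous_intros)
  moreover have "z0 \<in> stereo -` G \<inter> {z. poly q z \<noteq> 0}" using G(2) z0 by simp
  ultimately obtain r where r: "r > 0" "ball z0 r \<subseteq> stereo -` G \<inter> {z. poly q z \<noteq> 0}"
    by (rule openE)
  let ?g = "\<lambda>z. poly p z / poly q z"
  have "\<not> ?g constant_on ball z0 r"
  proof
    assume "?g constant_on ball z0 r"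
    then obtain c where c: "\<And>z. z \<in> ball z0 r \<Longrightarrow> ?g z = c" unfolding constant_on_def by blast
    have "ball z0 r \<subseteq> {z. poly (p - smult c q) z = 0}"
    proof
      fix z assume z: "z \<in> ball z0 r"
      then have "poly q z \<noteq> 0" using r by blast
      then show "z \<in> {z. poly (p - smult c q) z = 0}" using c[OF z] by (simp add: field_simps)
    qed
    moreover have "infinite (ball z0 r)"
      using r(1) by (metis islimpt_ball centre_in_ball ball_subset_cball islimpt_finite less_imp_le islimpt_subset mem_cball dist_self)
    ultimately have "p - smult c q = 0"
      using poly_roots_finite finite_subset by blast
    then show False using representsD(5)[OF F, of c] by simp
  qed
  moreover have "?g holomorphic_on ball z0 r"
    using r(2) by (intro holomorphic_intros) auto
  ultimately have "open (?g ` ball z0 r)"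
    by (intro open_mapping_thm[of ?g "ball z0 r"]) auto
  then have op: "openin (top_of_set S2) (stereo ` ?g ` ball z0 r)" by (rule openin_stereo_image)
  have eq: "F (stereo z) = stereo (?g z)" if "z \<in> ball z0 r" for z
    using represents_eq[OF F] r(2) that by blast
  have z0r: "z0 \<in> ball z0 r" using r(1) by simp
  have "F (stereo z0) \<in> stereo ` ?g ` ball z0 r"
    unfolding eq[OF z0r] using z0r by (intro imageI)
  moreover have "stereo ` ?g ` ball z0 r \<subseteq> F ` G"
  proof
    fix y assume "y \<in> stereo ` ?g ` ball z0 r"
    then obtain z where z: "z \<in> ball z0 r" "y = stereo (?g z)" by blast
    then have "stereo z \<in> G" using r(2) by blast
    then show "y \<in> F ` G" using eq[OF z(1)] z(2) by (metis imageI)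
  qed
  ultimately show "\<exists>H. openin (top_of_set S2) H \<and> F (stereo z0) \<in> H \<and> H \<subseteq> F ` G"
    using op by (intro exI conjI)
qed

text \<open>Inversion in the target exchanges numerator and denominator.\<close>

lemma represents_inversion:
  assumes F: "represents F p q"
  shows "represents (sphere_inversion \<circ> F) q p"
proof -
  obtain E where E: "finite E" "\<And>z. z \<notin> E \<Longrightarrow> F (stereo z) = stereo (poly p z / poly q z)"
    using F unfolding represents_def by blast
  \<comment> \<open>The zeros of \<open>p\<close> and \<open>q\<close> are excluded so that the
    quotient is nonzero, as the formula for \<open>sphere_inversion\<close> on the chart
    requires.\<close>
  let ?E = "E \<union> {z. poly p z = 0} \<union> {z. poly q z = 0}"
  have fin: "finite ?E"
    using E(1) poly_roots_finite[OF representsD(3)[OF F]] poly_roots_finite[OF representsD(4)[OF F]] by simp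
  have eq: "(sphere_inversion \<circ> F) (stereo z) = stereo (poly q z / poly p z)" if "z \<notin> ?E" for z
    using that E(2) by (simp add: sphere_inversion_stereo)
  show ?thesis
    unfolding represents_def
  proof (intro conjI allI)
    show "continuous_on S2 (sphere_inversion \<circ> F)"
      using representsD(1)[OF F] by (intro continuous_on_compose continuous_on_sphere_inversion)
    show "(sphere_inversion \<circ> F) ` S2 \<subseteq> S2"
      using representsD(2)[OF F] by (auto simp: sphere_inversion_simps)
    show "q \<noteq> smult c p" "p \<noteq> smult c q" for c
      by (rule representsD[OF F])+
    show "\<exists>E. finite E \<and> (\<forall>z. z \<notin> E \<longrightarrow>
        (sphere_inversion \<circ> F) (stereo z) = stereo (poly q z / poly p z))"
      using fin eq by (intro exI[of _ ?E]) simp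
  qed
qed

text \<open>At a pole, inversion in the target reduces to the previous case; undoing it preserves
  open sets.\<close>

lemma represents_open_at:
  assumes F: "represents F p q" and z0: "poly p z0 \<noteq> 0 \<or> poly q z0 \<noteq> 0"
  shows "locally_open_at F (stereo z0)"
proof (cases "poly q z0 = 0")
  case True
  then have o: "locally_open_at (sphere_inversion \<circ> F) (stereo z0)"
    using represents_open_at_nonpole[OF represents_inversion[OF F]] z0 by blast
  show ?thesis
    unfolding locally_open_at_def
  proof (intro allI impI)
    fix G assume "openin (top_of_set S2) G \<and> stereo z0 \<in> G"
    then obtain H where H: "openin (top_of_set S2) H" "(sphere_inversion \<circ> F) (stereo z0) \<in> H"
      "H \<subseteq> (sphere_inversion \<circ> F) ` G"
      using o unfolding locally_open_at_def by blast
    have "sphere_inversion ` H \<subseteq> F ` G"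
      using image_mono[OF H(3), of sphere_inversion] by (simp add: image_image sphere_inversion_simps)
    moreover have "F (stereo z0) \<in> sphere_inversion ` H"
      using H(2) sphere_inversion_simps(1) by (metis comp_apply imageI)
    ultimately show "\<exists>H. openin (top_of_set S2) H \<and> F (stereo z0) \<in> H \<and> H \<subseteq> F ` G"
      using openin_sphere_inversion_image[OF H(1)] by blast
  qed
qed (rule represents_open_at_nonpole[OF F])

lemma coprime_no_common_root:
  fixes p q :: "complex poly"
  assumes "coprime p q"
  shows "poly p z \<noteq> 0 \<or> poly q z \<noteq> 0"
proof (rule ccontr)
  assume "\<not> ?thesis"
  then have "[:- z, 1:] dvd p" "[:- z, 1:] dvd q" by (simp_all add: poly_eq_0_iff_dvd)
  then have "is_unit [:- z, 1:]" using assms coprime_common_divisor by blast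
  then show False by (simp add: is_unit_iff_degree)
qed

text \<open>If one of two coprime polynomials were a multiple of the other, the latter would be a
  unit and both would be constant, against \<open>d \<ge> 1\<close>.\<close>

lemma rational_map_represents:
  assumes "rational_map f d" "d \<ge> 1"
  obtains p q where "represents f p q" "coprime p q" "max (degree p) (degree q) = d"
proof -
  obtain p q where pq: "q \<noteq> 0" "coprime p q" "max (degree p) (degree q) = d"
    "\<And>z. poly q z \<noteq> 0 \<Longrightarrow> f (stereo z) = stereo (poly p z / poly q z)"
    using assms(1) unfolding rational_map_def by blast
  have np: "a \<noteq> smult c b" if ab: "coprime a b" "max (degree a) (degree b) \<ge> 1" for a b :: "complex poly" and c
  proof
    assume eq: "a = smult c b"
    then have "b dvd a" by (simp add: dvd_smult)
    then have "is_unit b" using ab(1) by (metis coprime_common_divisor dvd_refl)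
    then have "degree b = 0" by (metis is_unit_iff_degree not_is_unit_0)
    moreover have "degree a \<le> degree b" using eq degree_smult_le by blast
    ultimately show False using ab(2) by simp
  qed
  have "represents f p q"
    unfolding represents_def
  proof (intro conjI allI)
    show "\<exists>E. finite E \<and> (\<forall>z. z \<notin> E \<longrightarrow> f (stereo z) = stereo (poly p z / poly q z))"
      using poly_roots_finite[OF pq(1)] pq(4) by (intro exI[of _ "{z. poly q z = 0}"]) auto
    show "p \<noteq> smult c q" for c using np[OF pq(2)] pq(3) assms(2) by blast
    show "q \<noteq> smult c p" for c using np[of q p c] pq(2,3) assms(2) by (simp add: coprime_commute max.commute)
  qed (use assms(1) in \<open>auto simp: rational_map_def\<close>)
  then show ?thesis using that pq by blast
qed

lemma represents_at_infinity:
  assumes F: "represents f p q" and d: "max (degree p) (degree q) = d"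
  obtains P Q where "represents (f \<circ> sphere_inversion) P Q" "poly P 0 \<noteq> 0 \<or> poly Q 0 \<noteq> 0"
proof -
  \<comment> \<open>\<open>R a\<close> is \<open>z ^ d * a (1 / z)\<close> as a polynomial: the
    monomial raises the factor from \<open>degree a\<close> to \<open>d\<close>, so
    \<open>R p\<close> and \<open>R q\<close> keep the quotient. Its value at 0 is the leading
    coefficient when \<open>degree a = d\<close>.\<close>
  define R where "R = (\<lambda>a :: complex poly. monom 1 (d - degree a) * reflect_poly a)"
  have R: "poly (R a) z = z ^ d * poly a (inverse z)" if "degree a \<le> d" "z \<noteq> 0" for a z
  proof -
    have "poly (R a) z = z ^ (d - degree a) * (z ^ degree a * poly a (inverse z))"
      unfolding R_def using that(2) by (simp add: poly_monom poly_reflect_poly_nz)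
    then show ?thesis using that(1) by (simp add: power_add[symmetric] mult.assoc[symmetric])
  qed
  have deg: "degree p \<le> d" "degree q \<le> d" using d by auto
  have nz: "poly (R a) 0 \<noteq> 0" if "degree a = d" "a \<noteq> 0" for a
    using that(2) unfolding R_def that(1)[symmetric] by simp
  obtain E where E: "finite E" "\<And>z. z \<notin> E \<Longrightarrow> f (stereo z) = stereo (poly p z / poly q z)"
    using F unfolding represents_def by blast
  have nprop: "R a \<noteq> smult c (R b)" if ab: "a \<noteq> smult c b" "degree a \<le> d" "degree b \<le> d" for a b c
  proof
    assume eq: "R a = smult c (R b)"
    have "poly a z = poly (smult c b) z" if "z \<noteq> 0" for z
      using arg_cong[OF eq, of "\<lambda>r. poly r (inverse z)"] R[OF ab(2), of "inverse z"] R[OF ab(3), of "inverse z"] that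
      by simp
    then have "- {0} \<subseteq> {z. poly (a - smult c b) z = 0}" by auto
    moreover have "infinite (- {0 :: complex})" by (simp add: infinite_UNIV_char_0)
    ultimately have "a - smult c b = 0" using poly_roots_finite finite_subset by blast
    then show False using ab(1) by simp
  qed
  have "represents (f \<circ> sphere_inversion) (R p) (R q)"
    unfolding represents_def
  proof (intro conjI allI)
    show "continuous_on S2 (f \<circ> sphere_inversion)"
      using representsD(1)[OF F]
      by (intro continuous_on_compose continuous_on_sphere_inversion)
        (auto simp: sphere_inversion_simps intro: continuous_on_subset)
    show "(f \<circ> sphere_inversion) ` S2 \<subseteq> S2"
      using representsD(2)[OF F] by (auto simp: sphere_inversion_simps)
    show "R p \<noteq> smult c (R q)" "R q \<noteq> smult c (R p)" for c
      using nprop representsD(5,6)[OF F] deg by auto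
    have "(f \<circ> sphere_inversion) (stereo z) = stereo (poly (R p) z / poly (R q) z)"
      if "z \<notin> insert 0 (inverse ` E)" for z
    proof -
      have "z \<noteq> 0" "inverse z \<notin> E" using that by (auto simp: image_iff)
      then show ?thesis
        using E(2) R[OF deg(1)] R[OF deg(2)] by (simp add: sphere_inversion_stereo)
    qed
    then show "\<exists>E. finite E \<and> (\<forall>z. z \<notin> E \<longrightarrow>
        (f \<circ> sphere_inversion) (stereo z) = stereo (poly (R p) z / poly (R q) z))"
      using E(1) by (intro exI[of _ "insert 0 (inverse ` E)"]) auto
  qed
  moreover have "poly (R p) 0 \<noteq> 0 \<or> poly (R q) 0 \<noteq> 0"
    using nz[of p] nz[of q] d representsD(3,4)[OF F] by (auto simp: max_def split: if_splits)
  ultimately show ?thesis using that by blast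
qed

lemma rational_map_open:
  assumes f: "rational_map f d" "d \<ge> 1" and G: "openin (top_of_set S2) G"
  shows "openin (top_of_set S2) (f ` G)"
proof -
  obtain p q where F: "represents f p q" "coprime p q" "max (degree p) (degree q) = d"
    using rational_map_represents[OF f] by blast
  have fin: "locally_open_at f (stereo z)" for z
    using represents_open_at[OF F(1)] coprime_no_common_root[OF F(2)] by blast
  have north: "locally_open_at f north"
    unfolding locally_open_at_def
  proof (intro allI impI, elim conjE)
    fix G' assume G': "openin (top_of_set S2) G'" "north \<in> G'"
    obtain P Q where PQ: "represents (f \<circ> sphere_inversion) P Q" "poly P 0 \<noteq> 0 \<or> poly Q 0 \<noteq> 0"
      using represents_at_infinity[OF F(1,3)] by blast
    have "stereo 0 \<in> sphere_inversion ` G'"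
      using G'(2) sphere_inversion_simps(3) by (metis imageI)
    then obtain H where H: "openin (top_of_set S2) H" "(f \<circ> sphere_inversion) (stereo 0) \<in> H"
      "H \<subseteq> (f \<circ> sphere_inversion) ` sphere_inversion ` G'"
      using represents_open_at[OF PQ] openin_sphere_inversion_image[OF G'(1)]
      unfolding locally_open_at_def by blast
    have "sphere_inversion (stereo 0) = north" by (metis sphere_inversion_simps(1,3))
    then show "\<exists>H. openin (top_of_set S2) H \<and> f north \<in> H \<and> H \<subseteq> f ` G'"
      using H by (auto simp: image_image sphere_inversion_simps(1))
  qed
  have at: "locally_open_at f u" if "u \<in> S2" for u
    using that fin north unfolding S2_eq by blast
  show ?thesis
  proof (subst openin_subopen, intro ballI)
    fix y assume "y \<in> f ` G"
    then obtain u where "u \<in> G" "y = f u" by blast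
    then show "\<exists>T. openin (top_of_set S2) T \<and> y \<in> T \<and> T \<subseteq> f ` G"
      using at[of u] G openin_imp_subset unfolding locally_open_at_def by blast
  qed
qed

text \<open>Apart from \<open>north\<close> and the poles, a point over \<open>y\<close> is a root
  of the nonzero polynomial \<open>p - smult (stereo_inv y) q\<close>.\<close>

lemma rational_map_finite_fibre:
  assumes f: "rational_map f d" "d \<ge> 1"
  shows "finite (S2 \<inter> f -` {y})"
proof -
  obtain p q where F: "represents f p q"
    using rational_map_represents[OF f] by blast
  let ?Z = "{z. poly q z = 0} \<union> {z. poly (p - smult (stereo_inv y) q) z = 0}"
  have "S2 \<inter> f -` {y} \<subseteq> insert north (stereo ` ?Z)"
  proof
    fix u assume u: "u \<in> S2 \<inter> f -` {y}"
    show "u \<in> insert north (stereo ` ?Z)"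
    proof (cases "u = north")
      case False
      then obtain z where z: "u = stereo z" using u unfolding S2_eq by blast
      have "z \<in> ?Z"
      proof (rule ccontr)
        assume nz: "z \<notin> ?Z"
        then have "y = stereo (poly p z / poly q z)"
          using represents_eq[OF F, of z] u z by auto
        then have "stereo_inv y = poly p z / poly q z" by (simp add: stereo_inv_stereo)
        then have "poly (p - smult (stereo_inv y) q) z = 0" using nz by simp
        then show False using nz by blast
      qed
      then show ?thesis using z by blast
    qed simp
  qed
  moreover have "p - smult (stereo_inv y) q \<noteq> 0" using representsD(5)[OF F] by simp
  then have "finite ?Z" using representsD(4)[OF F] poly_roots_finite by blast
  ultimately show ?thesis using finite_subset by blast
qed

section \<open>Lifting points and continua through a rational map\<close>

lemma compact_S2: "compact S2"
  unfolding S2_def by (rule compact_sphere)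

lemma rational_map_surj:
  assumes f: "rational_map f d" "d \<ge> 1"
  shows "f ` S2 = S2"
proof -
  have cf: "continuous_on S2 f" and sub: "f ` S2 \<subseteq> S2" using f(1) unfolding rational_map_def by auto
  have "openin (top_of_set S2) (f ` S2)" using rational_map_open[OF f] by simp
  moreover have "compact (f ` S2)" using compact_continuous_image[OF cf compact_S2] .
  then have "closedin (top_of_set S2) (f ` S2)" using sub by (simp add: closed_subset compact_imp_closed)
  moreover have "connected S2" unfolding S2_def by (rule connected_sphere) simp
  moreover have "S2 \<noteq> {}" using stereo_in_S2 by blast
  ultimately show ?thesis using connected_clopen by blast
qed

text \<open>Take \<open>w n\<close> as the point over \<open>x n\<close> nearest to
  \<open>u\<close>. The image of a ball around \<open>u\<close> is an open neighbourhood of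
  \<open>f u\<close>, so it eventually contains \<open>x n\<close>, and \<open>w n\<close> is then
  in the ball.\<close>

lemma rational_map_lift_sequence:
  assumes f: "rational_map f d" "d \<ge> 1" and u: "u \<in> S2"
    and x: "\<And>n. x n \<in> S2" "x \<longlonglongrightarrow> f u"
  obtains w where "\<And>n. w n \<in> S2" "\<And>n. f (w n) = x n" "w \<longlonglongrightarrow> u"
proof -
  have cf: "continuous_on S2 f" using f(1) unfolding rational_map_def by auto
  have "\<exists>w. w \<in> S2 \<inter> f -` {x n} \<and> (\<forall>v \<in> S2 \<inter> f -` {x n}. dist u w \<le> dist u v)" for n
  proof -
    have "x n \<in> f ` S2" using rational_map_surj[OF f] x(1)[of n] by simp
    then have ne: "S2 \<inter> f -` {x n} \<noteq> {}" by auto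
    have cl: "closed (S2 \<inter> f -` {x n})"
      using finite_imp_closed[OF rational_map_finite_fibre[OF f]] .
    show ?thesis
      by (rule distance_attains_inf[OF cl ne, of u]) blast
  qed
  then obtain w where w: "\<And>n. w n \<in> S2 \<inter> f -` {x n}"
    "\<And>n v. v \<in> S2 \<inter> f -` {x n} \<Longrightarrow> dist u (w n) \<le> dist u v" by metis
  have "w \<longlonglongrightarrow> u"
  proof (rule tendstoI)
    fix e :: real assume e: "e > 0"
    have "openin (top_of_set S2) (f ` (S2 \<inter> ball u e))"
      by (rule rational_map_open[OF f]) (simp add: openin_open_Int)
    then obtain O' where O': "open O'" "f ` (S2 \<inter> ball u e) = S2 \<inter> O'" by (auto simp: openin_open)
    have "f u \<in> O'" using O' u e by (metis IntI Int_iff centre_in_ball imageI)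
    then have "\<forall>\<^sub>F n in sequentially. x n \<in> O'" using x(2) O'(1) topological_tendstoD by blast
    then show "\<forall>\<^sub>F n in sequentially. dist (w n) u < e"
    proof (rule eventually_mono)
      fix n assume "x n \<in> O'"
      then have "x n \<in> f ` (S2 \<inter> ball u e)" using O' x(1) by blast
      then obtain v where "v \<in> S2" "v \<in> ball u e" "x n = f v" by blast
      then show "dist (w n) u < e" using w(2)[of v n] by (simp add: dist_commute)
    qed
  qed
  then show ?thesis using that w(1) by blast
qed

text \<open>A nonempty clopen part of the preimage of \<open>P\<close> has clopen image in the
  connected \<open>P\<close>, hence maps onto it. If \<open>Q\<close> missed the fibre over
  \<open>y\<close>, finitely many clopen sets around \<open>Q\<close> would exclude all of this
  finite fibre, and so would their intersection.\<close>

lemma rational_map_component_onto: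
  assumes f: "rational_map f d" "d \<ge> 1" and P: "compact P" "connected P" "P \<subseteq> S2"
    and Q: "Q \<in> components (S2 \<inter> f -` P)"
  shows "f ` Q = P"
proof (rule ccontr)
  assume "f ` Q \<noteq> P"
  have cf: "continuous_on S2 f" using f(1) unfolding rational_map_def by auto
  define E where "E = S2 \<inter> f -` P"
  have QE: "Q \<subseteq> E" using Q in_components_subset unfolding E_def by blast
  then obtain y where y: "y \<in> P" "y \<notin> f ` Q" using \<open>f ` Q \<noteq> P\<close> unfolding E_def by blast
  have "closed E" unfolding E_def
    using continuous_closed_preimage[OF cf] compact_S2 P(1) compact_imp_closed by blast
  then have E: "compact E" unfolding E_def using compact_S2 by (metis closed_Int_compact inf.left_idem inf_commute)
  have onto: "f ` H = P" if H: "openin (top_of_set E) H" "closedin (top_of_set E) H" "H \<noteq> {}" for H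
  proof -
    have HE: "H \<subseteq> E" using H(1) openin_imp_subset by blast
    have "compact H" using closedin_compact[OF E H(2)] .
    then have "compact (f ` H)"
      using compact_continuous_image continuous_on_subset[OF cf] HE unfolding E_def by blast
    then have cl: "closedin (top_of_set P) (f ` H)"
      using HE unfolding E_def by (intro closed_subset compact_imp_closed) auto
    obtain O' where O': "open O'" "H = E \<inter> O'" using H(1) by (auto simp: openin_open)
    have "openin (top_of_set S2) (f ` (S2 \<inter> O'))"
      by (rule rational_map_open[OF f]) (simp add: openin_open_Int O')
    then obtain O'' where O'': "open O''" "f ` (S2 \<inter> O') = S2 \<inter> O''" by (auto simp: openin_open)
    \<comment> \<open>\<open>E\<close> is the full preimage of \<open>P\<close>, so intersecting the
      image with \<open>P\<close> loses nothing.\<close>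
    have "f ` H = f ` (S2 \<inter> O') \<inter> P" unfolding O'(2) E_def by blast
    then have "f ` H = P \<inter> O''" using O''(2) P(3) by blast
    then have "openin (top_of_set P) (f ` H)" using O''(1) by (simp add: openin_open_Int)
    then show ?thesis using cl P(2) H(3) connected_clopen by blast
  qed
  let ?Fb = "S2 \<inter> f -` {y}"
  have "\<exists>H. Q \<subseteq> H \<and> openin (top_of_set E) H \<and> closedin (top_of_set E) H \<and> v \<notin> H" if "v \<in> ?Fb" for v
  proof -
    have "v \<notin> Q" using that y by blast
    then show ?thesis
      using Sura_Bura_compact[OF E Q[folded E_def]] by blast
  qed
  then obtain H where H: "\<And>v. v \<in> ?Fb \<Longrightarrow> Q \<subseteq> H v" "\<And>v. v \<in> ?Fb \<Longrightarrow> openin (top_of_set E) (H v)"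
    "\<And>v. v \<in> ?Fb \<Longrightarrow> closedin (top_of_set E) (H v)" "\<And>v. v \<in> ?Fb \<Longrightarrow> v \<notin> H v" by metis
  define H0 where "H0 = \<Inter>(insert E (H ` ?Fb))"
  have fin: "finite (insert E (H ` ?Fb))" using rational_map_finite_fibre[OF f] by blast
  have "openin (top_of_set E) H0" unfolding H0_def
    using fin H(2) by (intro openin_Inter) auto
  moreover have "closedin (top_of_set E) H0" unfolding H0_def
    using H(3) by (intro closedin_Inter) auto
  moreover have "Q \<subseteq> H0" unfolding H0_def using H(1) QE by blast
  then have "H0 \<noteq> {}" using Q in_components_nonempty by blast
  ultimately have "y \<in> f ` H0" using onto y(1) by blast
  then obtain v where "v \<in> H0" "y = f v" by blast
  moreover have "v \<in> ?Fb" using calculation unfolding H0_def E_def by blast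
  ultimately show False using H(4)[of v] unfolding H0_def by blast
qed

section \<open>Schoenflies pairs and the induced relation\<close>

lemma hausdorff_limit_sequence:
  assumes "hausdorff_limit P A" "x \<in> A" and P: "\<And>n. compact (P n)" "\<And>n. P n \<noteq> {}"
  obtains s where "\<And>n. s n \<in> P n" "s \<longlonglongrightarrow> x"
proof -
  have "\<exists>s. s \<in> P n \<and> (\<forall>p\<in>P n. dist x s \<le> dist x p)" for n
    by (rule distance_attains_inf[OF compact_imp_closed[OF P(1)] P(2), of n x]) blast
  then obtain s where s: "\<And>n. s n \<in> P n" "\<And>n p. p \<in> P n \<Longrightarrow> dist x (s n) \<le> dist x p" by metis
  have "s \<longlonglongrightarrow> x"
  proof (rule tendstoI)
    fix e :: real assume "e > 0"
    then have "\<forall>\<^sub>F n in sequentially. (\<forall>p\<in>P n. \<exists>a\<in>A. dist p a < e) \<and> (\<forall>a\<in>A. \<exists>p\<in>P n. dist a p < e)"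
      using assms(1) unfolding hausdorff_limit_def by blast
    then have "\<forall>\<^sub>F n in sequentially. \<exists>p\<in>P n. dist x p < e"
      by (rule eventually_mono) (use assms(2) in blast)
    then show "\<forall>\<^sub>F n in sequentially. dist (s n) x < e"
      by (rule eventually_mono) (use s(2) dist_commute order_le_less_trans in metis)
  qed
  then show ?thesis using that s(1) by blast
qed

lemma proj_set_fibre:
  assumes D: "monotone_decomp L D" and L: "A \<subseteq> L"
  shows "proj_set D A = cls D ` A"
proof -
  have "cls D u \<in> D" "u \<in> cls D u" if "u \<in> A" for u
    using cls_in[OF D subsetD[OF L that]] by simp_all
  then show ?thesis unfolding proj_set_def using cls_eq[OF D] by blast
qed

text \<open>Lift points of \<open>P n\<close> tending to \<open>x\<close> to points tending to
  \<open>u\<close>, and let \<open>Q n\<close> be the component of \<open>M\<close> through the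
  lift. As \<open>Q n\<close> maps onto \<open>P n\<close>, it also contains points over a sequence
  tending to \<open>y\<close>, and \<open>v\<close> is one of their cluster points.\<close>

lemma schoenflies_rel_same_class:
  assumes f: "rational_map f d" "d \<ge> 1" and K: "compact K" "K \<subseteq> S2"
    and D: "monotone_decomp (S2 \<inter> f -` K) D" "peano_space (decomp_topology (S2 \<inter> f -` K) D)"
    and xy: "(x, y) \<in> schoenflies_rel K" and u: "u \<in> S2" "f u = x"
  obtains v where "v \<in> S2" "f v = y" "cls D u = cls D v"
proof -
  obtain J1 J2 U P A where J: "simple_closed_curve J1" "simple_closed_curve J2" "J1 \<inter> J2 = {}"
    and U: "is_U J1 J2 U" and "inj P"
    and P: "\<And>n. P n \<in> components (closure U \<inter> K)" "\<And>n. P n \<inter> J1 \<noteq> {}" "\<And>n. P n \<inter> J2 \<noteq> {}"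
    and A: "hausdorff_limit P A" "x \<in> A" "y \<in> A"
    using xy unfolding schoenflies_rel_def by blast
  note UD = is_U_D[OF J(1,2) U]
  have cf: "continuous_on S2 f" using f(1) unfolding rational_map_def by auto
  have cUK: "compact (closure U \<inter> K)" using K(1) by (simp add: closed_Int_compact)
  have Pc: "compact (P n)" "connected (P n)" "P n \<subseteq> closure U \<inter> K" "P n \<noteq> {}" for n
    using P(1)[of n] cUK compact_components in_components_connected in_components_subset
      in_components_nonempty by blast+
  have Pd: "P m \<inter> P n = {}" if "m \<noteq> n" for m n
    using components_nonoverlap[OF P(1) P(1)] that injD[OF \<open>inj P\<close>] by blast
  define L where "L = S2 \<inter> f -` K"
  define M where "M = S2 \<inter> f -` (closure U \<inter> K)"
  define T where "T = S2 \<inter> f -` (J1 \<union> J2)"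
  have pre: "compact (S2 \<inter> f -` C)" if "closed C" for C
    using continuous_closed_preimage[OF cf compact_imp_closed[OF compact_S2] that] compact_S2
    by (metis closed_Int_compact inf.left_idem inf_commute)
  have L: "compact L" unfolding L_def by (rule pre[OF compact_imp_closed[OF K(1)]])
  have M: "compact M" "M \<subseteq> L"
    unfolding M_def L_def by (rule pre[OF compact_imp_closed[OF cUK]]) auto
  have T: "closed T" unfolding T_def
    by (intro compact_imp_closed[OF pre] closed_Un compact_imp_closed[OF simple_closed_curve_nonempty(2)] J)
  \<comment> \<open>\<open>M - T\<close> is the part of \<open>L\<close> over \<open>U\<close>,
    which is open in the sphere.\<close>
  have MT: "openin (top_of_set L) (M - T)"
  proof -
    obtain O' where O': "open O'" "U = S2 \<inter> O'" using UD(1) by (auto simp: openin_open)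
    have fS: "f ` S2 \<subseteq> S2" using f(1) unfolding rational_map_def by auto
    have "closure U - (J1 \<union> J2) = U" using UD(4,6) closure_subset by blast
    then have "M - T = S2 \<inter> f -` (U \<inter> K)" unfolding M_def T_def by blast
    then have "M - T = L \<inter> f -` O'" using O'(2) fS unfolding L_def by blast
    moreover have "continuous_on L f" using cf continuous_on_subset unfolding L_def by blast
    ultimately show ?thesis using continuous_openin_preimage_gen O'(1) by metis
  qed
  obtain xs where xs: "\<And>n. xs n \<in> P n" "xs \<longlonglongrightarrow> x"
    using hausdorff_limit_sequence[OF A(1,2) Pc(1,4)] by blast
  obtain ys where ys: "\<And>n. ys n \<in> P n" "ys \<longlonglongrightarrow> y"
    using hausdorff_limit_sequence[OF A(1,3) Pc(1,4)] by blast
  have PS: "P n \<subseteq> S2" for n using Pc(3) K(2) by blast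
  obtain us where us: "\<And>n. us n \<in> S2" "\<And>n. f (us n) = xs n" "us \<longlonglongrightarrow> u"
    using rational_map_lift_sequence[OF f u(1), of xs] xs PS u(2) by blast
  define Q where "Q = (\<lambda>n. connected_component_set M (us n))"
  have usM: "us n \<in> M" for n unfolding M_def using us xs Pc(3)[of n] by auto
  have Q: "Q n \<in> components M" "us n \<in> Q n" for n
    unfolding Q_def using usM by (auto simp: components_def)
  have QM: "Q n \<subseteq> M" for n using Q(1) in_components_subset by blast
  \<comment> \<open>The image is connected and meets the component \<open>P n\<close>, so it stays
    inside. Hence \<open>Q n\<close> is also a component of the preimage of \<open>P n\<close>
    alone, and maps onto it.\<close>
  have fQ: "f ` Q n = P n" for n
  proof -
    have "continuous_on (Q n) f" using cf QM[of n] continuous_on_subset unfolding M_def by blast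
    then have "connected (f ` Q n)"
      using connected_continuous_image in_components_connected[OF Q(1)] by blast
    moreover have "f ` Q n \<subseteq> closure U \<inter> K" using QM[of n] unfolding M_def by blast
    moreover have "f ` Q n \<inter> P n \<noteq> {}" using Q(2)[of n] us(2)[of n] xs(1)[of n] by auto
    ultimately have "f ` Q n \<subseteq> P n" using components_maximal[OF P(1)] by blast
    then have "Q n \<subseteq> S2 \<inter> f -` P n" using QM[of n] unfolding M_def by blast
    moreover have "S2 \<inter> f -` P n \<subseteq> M" using Pc(3) unfolding M_def by blast
    ultimately have "Q n \<in> components (S2 \<inter> f -` P n)"
      using components_intermediate_subset[OF Q(1)] by blast
    then show ?thesis by (rule rational_map_component_onto[OF f Pc(1,2) PS])
  qed
  have Qinj: "inj Q"
  proof (rule injI)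
    fix m n assume "Q m = Q n"
    then have "P m = P n" using fQ by metis
    then show "m = n" using injD[OF \<open>inj P\<close>] by blast
  qed
  have "\<exists>v. v \<in> Q n \<and> f v = ys n" for n using fQ[of n] ys(1)[of n] by (metis imageE)
  then obtain vs where vs: "\<And>n. vs n \<in> Q n" "\<And>n. f (vs n) = ys n" by metis
  have "\<exists>a. a \<in> P n \<inter> J1" "\<exists>b. b \<in> P n \<inter> J2" for n using P(2,3) by blast+
  then obtain as bs where as: "\<And>n. as n \<in> P n \<inter> J1" and bs: "\<And>n. bs n \<in> P n \<inter> J2" by metis
  have "compact (K \<times> K \<times> S2)" using K(1) compact_S2 by (intro compact_Times)
  moreover have "(as n, bs n, vs n) \<in> K \<times> K \<times> S2" for n
    using as[of n] bs[of n] vs(1)[of n] Pc(3)[of n] QM[of n] unfolding M_def by blast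
  ultimately obtain l r where l: "l \<in> K \<times> K \<times> S2" "strict_mono r" "((\<lambda>n. (as n, bs n, vs n)) \<circ> r) \<longlonglongrightarrow> l"
    unfolding compact_def by (metis (no_types, lifting))
  obtain a b v where abv: "l = (a, b, v)" by (cases l)
  have lim: "(as \<circ> r) \<longlonglongrightarrow> a" "(bs \<circ> r) \<longlonglongrightarrow> b" "(vs \<circ> r) \<longlonglongrightarrow> v"
    using tendsto_fst[OF l(3)] tendsto_fst[OF tendsto_snd[OF l(3)]] tendsto_snd[OF tendsto_snd[OF l(3)]]
    unfolding abv o_def by auto
  have vS: "v \<in> S2" using l(1) abv by simp
  have QS: "Q n \<subseteq> S2" for n using QM unfolding M_def by blast
  have "(\<lambda>n. f (vs (r n))) \<longlonglongrightarrow> f v"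
    by (rule continuous_on_tendsto_compose[OF cf lim(3)[unfolded o_def] vS])
      (use vs(1) QS in \<open>auto intro!: always_eventually\<close>)
  then have "(ys \<circ> r) \<longlonglongrightarrow> f v" using vs(2) by (simp add: o_def)
  then have fv: "f v = y"
    by (rule LIMSEQ_unique[OF _ LIMSEQ_subseq_LIMSEQ[OF ys(2) l(2)]])
  let ?F = "S2 \<inter> f -` {a} \<union> S2 \<inter> f -` {b}"
  have clus: "t0 \<in> ?F" if r': "strict_mono r'" and t: "\<And>n. t n \<in> Q (r (r' n)) \<inter> T" "t \<longlonglongrightarrow> t0" for r' t t0
  proof -
    have tS: "t n \<in> S2" for n using t(1) QS by blast
    have t0S: "t0 \<in> S2"
      using closed_sequentially[OF compact_imp_closed[OF compact_S2] tS t(2)] .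
    have ft: "(\<lambda>n. f (t n)) \<longlonglongrightarrow> f t0"
      by (rule continuous_on_tendsto_compose[OF cf t(2) t0S]) (simp add: tS)
    have hit: "f (t n) \<in> P (r (r' n)) \<inter> (J1 \<union> J2)" for n
      using t(1)[of n] fQ[of "r (r' n)"] unfolding T_def by blast
    \<comment> \<open>Kept general in the curves, because it is used for both orders of
      \<open>J1\<close> and \<open>J2\<close>: the points \<open>f (t n)\<close> lie on at least one
      of them infinitely often.\<close>
    have one: "f t0 = c"
      if J: "simple_closed_curve J" "simple_closed_curve J'" "J \<inter> J' = {}" "is_U J J' U"
        and PJ: "\<And>n. P n \<inter> J' \<noteq> {}" and inf: "infinite {n. f (t n) \<in> J}"
        and cs: "\<And>n. cs n \<in> P n \<inter> J" "(cs \<circ> r) \<longlonglongrightarrow> c" for J J' cs c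
    proof -
      obtain r2 :: "nat \<Rightarrow> nat" where r2: "strict_mono r2" "\<And>n. f (t (r2 n)) \<in> J"
        using infinite_enumerate[OF inf] by auto
      have sm: "strict_mono (\<lambda>n. r' (r2 n))" "strict_mono (\<lambda>n. r (r' (r2 n)))"
        using r' r2(1) l(2) by (auto simp: strict_mono_def)
      show "f t0 = c"
      proof (rule ends_not_separated_S2[OF J, where P = "\<lambda>n. P (r (r' (r2 n)))"])
        show "P (r (r' (r2 m))) \<inter> P (r (r' (r2 n))) = {}" if "m \<noteq> n" for m n
          using Pd strict_mono_eq[OF sm(2)] that by blast
        show "f (t (r2 n)) \<in> P (r (r' (r2 n))) \<inter> J" for n using hit r2(2) by blast
        show "cs (r (r' (r2 n))) \<in> P (r (r' (r2 n))) \<inter> J" for n using cs(1) .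
        show "(\<lambda>n. f (t (r2 n))) \<longlonglongrightarrow> f t0"
          using LIMSEQ_subseq_LIMSEQ[OF ft r2(1)] by (simp add: o_def)
        show "(\<lambda>n. cs (r (r' (r2 n)))) \<longlonglongrightarrow> c"
          using LIMSEQ_subseq_LIMSEQ[OF cs(2) sm(1)] by (simp add: o_def)
      qed (use Pc PJ in auto)
    qed
    have "UNIV = {n. f (t n) \<in> J1} \<union> {n. f (t n) \<in> J2}" using hit by blast
    then have "infinite {n. f (t n) \<in> J1} \<or> infinite {n. f (t n) \<in> J2}"
      by (metis finite_UnI infinite_UNIV_nat)
    then have "f t0 = a \<or> f t0 = b"
      using one[OF J U P(3) _ as lim(1)] one[OF J(2,1) _ _ P(2) _ bs lim(2)] J(3) U
      by (auto simp: is_U_def Un_commute Int_commute)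
    then show ?thesis using t0S by blast
  qed
  have "cls D u = cls D v"
  proof (rule limit_of_components_in_one_class[OF D[folded L_def] L M T MT,
        where Q = "\<lambda>n. Q (r n)" and F = ?F and u = "us \<circ> r" and v = "vs \<circ> r"])
    show "inj (\<lambda>n. Q (r n))"
      using injD[OF Qinj] strict_mono_eq[OF l(2)] by (intro injI) metis
    show "finite ?F" using rational_map_finite_fibre[OF f] by blast
    show "(us \<circ> r) \<longlonglongrightarrow> u" using LIMSEQ_subseq_LIMSEQ[OF us(3) l(2)] .
    show "t0 \<in> ?F" if "strict_mono r'" "\<And>n. t n \<in> Q (r (r' n)) \<inter> T" "t \<longlonglongrightarrow> t0" for r' t t0
      by (rule clus[OF that])
  qed (use Q vs lim in auto)
  then show ?thesis using that vS fv by blast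
qed

text \<open>Each \<open>u\<close> over \<open>x\<close> is a limit of lifts of \<open>xs n\<close>;
  these share their classes with points over \<open>ys n\<close>, which cluster at a point over
  \<open>y\<close>. The relation of having equal classes is closed, so that point has the class of
  \<open>u\<close>.\<close>

lemma proj_set_fibre_limit:
  assumes f: "rational_map f d" "d \<ge> 1" and K: "compact K" "K \<subseteq> S2"
    and D: "monotone_decomp (S2 \<inter> f -` K) D"
    and xs: "\<And>n. xs n \<in> K" "xs \<longlonglongrightarrow> x" and ys: "\<And>n. ys n \<in> K" "ys \<longlonglongrightarrow> y"
    and sub: "\<And>n. proj_set D (S2 \<inter> f -` {xs n}) \<subseteq> proj_set D (S2 \<inter> f -` {ys n})"
  shows "proj_set D (S2 \<inter> f -` {x}) \<subseteq> proj_set D (S2 \<inter> f -` {y})"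
proof -
  have cf: "continuous_on S2 f" using f(1) unfolding rational_map_def by auto
  have xyK: "x \<in> K" "y \<in> K"
    using closed_sequentially[OF compact_imp_closed[OF K(1)]] xs ys by blast+
  have proj: "proj_set D (S2 \<inter> f -` {z}) = cls D ` (S2 \<inter> f -` {z})" if "z \<in> K" for z
    by (rule proj_set_fibre[OF D]) (use that in auto)
  have "cls D u \<in> cls D ` (S2 \<inter> f -` {y})" if u: "u \<in> S2" "f u = x" for u
  proof -
    have "xs n \<in> S2" for n using xs(1) K(2) by blast
    then obtain w where w: "\<And>n. w n \<in> S2" "\<And>n. f (w n) = xs n" "w \<longlonglongrightarrow> u"
      using rational_map_lift_sequence[OF f u(1), of xs] xs(2) u(2) by blast
    have "\<exists>v. v \<in> S2 \<inter> f -` {ys n} \<and> cls D (w n) = cls D v" for n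
      using sub[of n] w(1)[of n] w(2)[of n] unfolding proj[OF xs(1)] proj[OF ys(1)] by blast
    then obtain v where v: "\<And>n. v n \<in> S2 \<inter> f -` {ys n}" "\<And>n. cls D (w n) = cls D (v n)" by metis
    then have vS: "v n \<in> S2" for n by blast
    then obtain l r where l: "l \<in> S2" "strict_mono r" "(v \<circ> r) \<longlonglongrightarrow> l"
      using compact_S2 unfolding compact_def by (metis (no_types, lifting))
    have "(\<lambda>n. f (v (r n))) \<longlonglongrightarrow> f l"
      by (rule continuous_on_tendsto_compose[OF cf l(3)[unfolded o_def] l(1)]) (simp add: vS)
    then have "(ys \<circ> r) \<longlonglongrightarrow> f l" using v(1) by (simp add: o_def)
    then have fl: "f l = y"
      by (rule LIMSEQ_unique[OF _ LIMSEQ_subseq_LIMSEQ[OF ys(2) l(2)]])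
    have "cls D u = cls D l"
    proof (rule cls_closed_relation[OF D, where u = "w \<circ> r" and v = "v \<circ> r"])
      show "(w \<circ> r) \<longlonglongrightarrow> u" using LIMSEQ_subseq_LIMSEQ[OF w(3) l(2)] .
    qed (use u l fl w v xs(1) ys(1) xyK in auto)
    then show ?thesis using l(1) fl by blast
  qed
  then show ?thesis unfolding proj[OF xyK(1)] proj[OF xyK(2)] by blast
qed

lemma schoenflies_rel_sym:
  assumes "(x, y) \<in> schoenflies_rel K"
  shows "(y, x) \<in> schoenflies_rel K"
proof -
  obtain J1 J2 U P A where *: "x \<in> K" "y \<in> K" "x \<noteq> y"
    "simple_closed_curve J1" "simple_closed_curve J2" "J1 \<inter> J2 = {}" "x \<in> J1" "y \<in> J2"
    "is_U J1 J2 U" "inj P"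
    "\<forall>n. P n \<in> components (closure U \<inter> K) \<and> P n \<inter> J1 \<noteq> {} \<and> P n \<inter> J2 \<noteq> {}"
    "hausdorff_limit P A" "x \<in> A" "y \<in> A"
    using assms unfolding schoenflies_rel_def by blast
  have "\<exists>J1 J2 U P A. simple_closed_curve J1 \<and> simple_closed_curve J2 \<and> J1 \<inter> J2 = {} \<and>
        y \<in> J1 \<and> x \<in> J2 \<and> is_U J1 J2 U \<and> inj P \<and>
        (\<forall>n. P n \<in> components (closure U \<inter> K) \<and> P n \<inter> J1 \<noteq> {} \<and> P n \<inter> J2 \<noteq> {}) \<and>
        hausdorff_limit P A \<and> y \<in> A \<and> x \<in> A"
    by (rule exI[of _ J2], rule exI[of _ J1], rule exI[of _ U], rule exI[of _ P], rule exI[of _ A])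
      (use * in \<open>simp add: is_U_def Un_commute Int_commute\<close>)
  then show ?thesis
    using *(1-3) unfolding schoenflies_rel_def by simp
qed

theorem theorem7p1:
  fixes K :: "R3 set" and f :: "R3 \<Rightarrow> R3" and d :: nat and D :: "R3 set set"
  assumes "compact K" and "K \<subseteq> S2"
    and "rational_map f d" and "d \<ge> 2"
    and "finest_PS_decomp (S2 \<inter> f -` K) D"
  defines "approx \<equiv> {(x, y). x \<in> K \<and> y \<in> K \<and>
             proj_set D (S2 \<inter> f -` {x}) = proj_set D (S2 \<inter> f -` {y})}"
  shows "closed approx \<and> equiv K approx \<and> closure (schoenflies_rel K) \<subseteq> approx"
proof (intro conjI)
  have d: "d \<ge> 1" using assms(4) by simp
  have D: "monotone_decomp (S2 \<inter> f -` K) D" "peano_space (decomp_topology (S2 \<inter> f -` K) D)"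
    using assms(5) unfolding finest_PS_decomp_def by auto
  have approx_iff: "(x, y) \<in> approx \<longleftrightarrow> x \<in> K \<and> y \<in> K \<and>
      proj_set D (S2 \<inter> f -` {x}) = proj_set D (S2 \<inter> f -` {y})" for x y
    unfolding approx_def by simp
  show closed: "closed approx"
    unfolding closed_sequential_limits
  proof (intro allI impI, elim conjE)
    fix s l assume s: "\<forall>n. s n \<in> approx" "s \<longlonglongrightarrow> l"
    obtain x y where l: "l = (x, y)" by (cases l)
    have a: "fst (s n) \<in> K" "snd (s n) \<in> K"
      "proj_set D (S2 \<inter> f -` {fst (s n)}) = proj_set D (S2 \<inter> f -` {snd (s n)})" for n
      using s(1) approx_iff[of "fst (s n)" "snd (s n)"] by auto
    have t: "(\<lambda>n. fst (s n)) \<longlonglongrightarrow> x" "(\<lambda>n. snd (s n)) \<longlonglongrightarrow> y"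
      using tendsto_fst[OF s(2)] tendsto_snd[OF s(2)] l by auto
    have "x \<in> K" "y \<in> K"
      using closed_sequentially[OF compact_imp_closed[OF assms(1)] a(1) t(1)]
        closed_sequentially[OF compact_imp_closed[OF assms(1)] a(2) t(2)] by auto
    moreover have "proj_set D (S2 \<inter> f -` {x}) = proj_set D (S2 \<inter> f -` {y})"
      using proj_set_fibre_limit[OF assms(3) d assms(1,2) D(1) a(1) t(1) a(2) t(2)]
        proj_set_fibre_limit[OF assms(3) d assms(1,2) D(1) a(2) t(2) a(1) t(1)] a(3) by simp
    ultimately show "l \<in> approx" using l approx_iff by simp
  qed
  show "equiv K approx"
    by (rule equivI) (auto simp: refl_on_def sym_def trans_def approx_iff)
  \<comment> \<open>Only one inclusion is proved for a pair; the other follows from the symmetry of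
    \<open>schoenflies_rel K\<close>.\<close>
  have half: "proj_set D (S2 \<inter> f -` {x}) \<subseteq> proj_set D (S2 \<inter> f -` {y})"
    if xy: "(x, y) \<in> schoenflies_rel K" for x y
  proof -
    have xyK: "x \<in> K" "y \<in> K" using xy unfolding schoenflies_rel_def by auto
    have proj: "proj_set D (S2 \<inter> f -` {z}) = cls D ` (S2 \<inter> f -` {z})" if "z \<in> K" for z
      by (rule proj_set_fibre[OF D(1)]) (use that in auto)
    show ?thesis
      unfolding proj[OF xyK(1)] proj[OF xyK(2)]
      using schoenflies_rel_same_class[OF assms(3) d assms(1,2) D xy] by blast
  qed
  have "schoenflies_rel K \<subseteq> approx"
  proof
    fix p assume p: "p \<in> schoenflies_rel K"
    obtain x y where xy: "p = (x, y)" by (cases p)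
    have "x \<in> K" "y \<in> K" using p xy unfolding schoenflies_rel_def by auto
    then show "p \<in> approx"
      using half[of x y] half[of y x] schoenflies_rel_sym p approx_iff unfolding xy by blast
  qed
  then show "closure (schoenflies_rel K) \<subseteq> approx"
    using closed by (rule closure_minimal)
qed

end
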